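(* Let $M$ be a 2-semidominant ideal. Let $A=\{([\sigma_1],[\tau_1]),\dots,([\sigma_k],[\tau_k])\}$ be a family of pairs of basis elements of $\mathbb{T}_M$ having the following properties: (i) $([\sigma_i],[\tau_i])$ and $([\sigma_j],[\tau_j])$ are disjoint if $i\neq j$; (ii) $[\tau_i]$ is a facet of $[\sigma_i]$ for all $i=1,\dots,k$; (iii) $\operatorname{mdeg}[\sigma_i]=\operatorname{mdeg}[\tau_i]$ for all $i=1,\dots,k$; (iv) $A$ is maximal with respect to inclusion among the sets satisfying (i), (ii) and (iii). Then a minimal free resolution $\mathbb{F}$ of $S/M$ can be obtained from $\mathbb{T}_M$ by doing all standard cancellations $0\to S[\sigma]\to S[\tau]\to0$ with $([\sigma],[\tau])\in A$. In symbols, $$\mathbb{T}_M=\mathbb{F}\oplus\Big(\bigoplus_{([\sigma],[\tau])\in A}0\to S[\sigma]\to S[\tau]\to0\Big).$$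
   Context: $S$ is a polynomial ring in finitely many variables over an arbitrary field. For a monomial ideal $M$ of $S$ with minimal generating set $G=\{l_1,\dots,l_p\}$, the Taylor resolution $\mathbb{T}_M$ is the multigraded free resolution of $S/M$ whose free module in homological degree $j$ has basis the symbols $[l_{r_1},\dots,l_{r_j}]$, $r_1<\dots<r_j$ (one for each $j$-element subset of $G$), with $\operatorname{mdeg}[l_{r_1},\dots,l_{r_j}]=\operatorname{lcm}(l_{r_1},\dots,l_{r_j})$, and differential $f_j([l_{r_1},\dots,l_{r_j}])=\sum_{i=1}^j(-1)^{i+1}\frac{\operatorname{mdeg}[l_{r_1},\dots,l_{r_j}]}{\operatorname{mdeg}[l_{r_1},\dots,\widehat{l_{r_i}},\dots,l_{r_j}]}[l_{r_1},\dots,\widehat{l_{r_i}},\dots,l_{r_j}]$. The element $[l_{r_1},\dots,\widehat{l_{r_i}},\dots,l_{r_j}]$ is called a facet of $[l_{r_1},\dots,l_{r_j}]$. Pairs $([\sigma],[\tau])$ and $([\theta],[\pi])$ of basis elements are disjoint if $[\sigma]\neq[\theta],[\pi]$ and $[\tau]\neq[\theta],[\pi]$. Given a set $G$ of monomials, $m\in G$ is dominant (with respect to $G$) if there are a variable $x$ and an integer $k\ge1$ with $x^k\mid m$ and $x^k\nmid m'$ for all $m'\in G\setminus\{m\}$. A monomial ideal is 2-semidominant if its minimal generating set contains exactly two nondominant monomials. Standard cancellations. Let $\mathbb{F}$ be a multigraded free resolution of $S/M$ with a chosen multihomogeneous basis labelled by basis elements of $\mathbb{T}_M$ (e.g. $\mathbb{T}_M$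 itself), with differentials $f_j$. For $[\sigma]$ in homological degree $j$ and $[\tau]$ in degree $j-1$, let $a_{\tau\sigma}$ be the coefficient of $[\tau]$ in $f_j([\sigma])$. If $a_{\tau\sigma}$ is invertible, the standard change of basis around $a_{\tau\sigma}$ puts $[\sigma]'=[\sigma]$, $[\theta]'=[\theta]-\frac{a_{\tau\theta}}{a_{\tau\sigma}}[\sigma]$ for the other basis elements $[\theta]$ in degree $j$, $[\tau]'=f_j([\sigma])$, and $[\pi]'=[\pi]$ for the other basis elements $[\pi]$ in degree $j-1$. Multidegrees are preserved, and in the new bases the resolution splits as $\mathbb{F}'\oplus(0\to S[\sigma]'\to S[\tau]'\to0)$, with $\mathbb{F}'$ free on the remaining basis elements. Passing from $\mathbb{F}$ to $\mathbb{F}'$ is the standard cancellation $0\to S[\sigma]\to S[\tau]\to0$; it is possible exactly when the entry $a_{\tau\sigma}$ of the current resolution is invertible. Primes are dropped: the remaining basis elements keep their names, so the basis of $\mathbb{F}'$ is identified with a subset of the basis of $\mathbb{T}_M$. The displayed equality is understood with these identifications (i.e. up to the changes of basis). *)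

theory Defs
  imports Complex_Main "HOL-Library.Poly_Mapping"
begin

section \<open>Monomials, polynomials and monomial ideals\<close>

text \<open>
  A monomial is its exponent vector, so the product of monomials is \<open>+\<close> and the monomial \<open>1\<close> is
  \<open>0\<close>.  The order \<open>\<le>\<close> that the library puts on \<open>\<Rightarrow>\<^sub>0\<close> is lexicographic and is not used here.
\<close>

type_synonym 'n mon = "'n \<Rightarrow>\<^sub>0 nat"
type_synonym ('n, 'k) mpoly = "('n \<Rightarrow>\<^sub>0 nat) \<Rightarrow>\<^sub>0 'k"

definition mon_dvd :: "'n mon \<Rightarrow> 'n mon \<Rightarrow> bool" where
  "mon_dvd a b \<longleftrightarrow> (\<exists>c. b = a + c)"

definition monom :: "'n mon \<Rightarrow> ('n, 'k::field) mpoly" where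
  "monom m = Poly_Mapping.single m 1"

definition var_power :: "'n \<Rightarrow> nat \<Rightarrow> 'n mon" where
  "var_power x k = Poly_Mapping.single x k"

text \<open>
  The ring is a module over itself and its submodules are the ideals.  The locale is not interpreted
  globally, because its simp rule \<open>scale_scale\<close> would reassociate every product.
\<close>

lemma module_ring: "module ((*) :: 'r::comm_ring_1 \<Rightarrow> 'r \<Rightarrow> 'r)"
  by unfold_locales (simp_all add: algebra_simps)

definition ideal_generated :: "'r::comm_ring_1 set \<Rightarrow> 'r set" where
  "ideal_generated E = module.span (*) E"

definition monomial_ideal :: "('n, 'k::field) mpoly set \<Rightarrow> bool" where
  "monomial_ideal M \<longleftrightarrow> (\<exists>E. M = ideal_generated (monom ` E))"

definition minimal_generating_set :: "('n, 'k::field) mpoly set \<Rightarrow> 'n mon set \<Rightarrow> bool" where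
  "minimal_generating_set M G \<longleftrightarrow>
     ideal_generated (monom ` G) = M \<and> (\<forall>H. H \<subset> G \<longrightarrow> ideal_generated (monom ` H) \<noteq> M)"

definition dominant :: "'n mon set \<Rightarrow> 'n mon \<Rightarrow> bool" where
  "dominant G m \<longleftrightarrow> m \<in> G \<and>
     (\<exists>x k. k \<ge> 1 \<and> mon_dvd (var_power x k) m \<and>
            (\<forall>m'\<in>G - {m}. \<not> mon_dvd (var_power x k) m'))"

text \<open>
  A monomial ideal has exactly one minimal generating set of monomials, so the existential
  quantifier speaks about that set.
\<close>

definition two_semidominant :: "('n, 'k::field) mpoly set \<Rightarrow> bool" where
  "two_semidominant M \<longleftrightarrow> monomial_ideal M \<and>
     (\<exists>G. minimal_generating_set M G \<and> card {m \<in> G. \<not> dominant G m} = 2)"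

text \<open>The lcm, computed on exponents; the lcm of the empty set is \<open>1\<close>.\<close>

definition mdeg :: "('n::finite) mon set \<Rightarrow> 'n mon" where
  "mdeg \<sigma> = Abs_poly_mapping (\<lambda>x. Max (insert 0 ((\<lambda>l. Poly_Mapping.lookup l x) ` \<sigma>)))"

lemma lookup_mdeg:
  "Poly_Mapping.lookup (mdeg \<sigma>) x = Max (insert 0 ((\<lambda>l. Poly_Mapping.lookup l x) ` \<sigma>))"
  by (simp add: mdeg_def)


section \<open>The Taylor complex\<close>

text \<open>
  The symbol \<open>[l\<^sub>1, \<dots>, l\<^sub>j]\<close> is represented by the set \<open>{l\<^sub>1, \<dots>, l\<^sub>j}\<close>; its homological degree is
  the cardinality of that set.  Chains are elements of the free \<open>S\<close>-module on all such labels, in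
  which the Taylor modules of all degrees are contained.
\<close>

type_synonym 'n symbol = "'n mon set"
type_synonym ('n, 'k) chain = "'n symbol \<Rightarrow>\<^sub>0 ('n, 'k) mpoly"

definition smul :: "'r::comm_ring_1 \<Rightarrow> ('b \<Rightarrow>\<^sub>0 'r) \<Rightarrow> ('b \<Rightarrow>\<^sub>0 'r)" where
  "smul c v = Poly_Mapping.map ((*) c) v"

lemma lookup_smul: "Poly_Mapping.lookup (smul c v) i = c * Poly_Mapping.lookup v i"
  by (simp add: smul_def Poly_Mapping.map.rep_eq when_def)

interpretation free_mod: module "smul :: 'r::comm_ring_1 \<Rightarrow> ('b \<Rightarrow>\<^sub>0 'r) \<Rightarrow> ('b \<Rightarrow>\<^sub>0 'r)"
  by unfold_locales
    (rule poly_mapping_eqI; simp add: lookup_smul lookup_add distrib_left distrib_right mult.assoc)+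

definition taylor_basis :: "'n symbol \<Rightarrow> ('n, 'k::field) chain" where
  "taylor_basis \<sigma> = Poly_Mapping.single \<sigma> 1"

text \<open>
  The list \<open>ls\<close> enumerates the generators and fixes the signs.  Subtraction of exponent vectors is
  division of monomials.  Indices start at \<open>0\<close>, so the sign is \<open>(- 1) ^ i\<close>.
\<close>

definition taylor_boundary :: "('n::finite) mon list \<Rightarrow> 'n symbol \<Rightarrow> ('n, 'k::field) chain" where
  "taylor_boundary ls \<sigma> =
     (let rs = filter (\<lambda>l. l \<in> \<sigma>) ls in
      \<Sum>i<length rs. smul ((- 1) ^ i * monom (mdeg \<sigma> - mdeg (\<sigma> - {rs ! i})))
                        (taylor_basis (\<sigma> - {rs ! i})))"

definition taylor_diff ::
  "('n::finite) mon list \<Rightarrow> ('n, 'k::field) chain \<Rightarrow> ('n, 'k) chain" where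
  "taylor_diff ls v =
     (\<Sum>\<sigma>\<in>Poly_Mapping.keys v. smul (Poly_Mapping.lookup v \<sigma>) (taylor_boundary ls \<sigma>))"

definition facet :: "'n symbol \<Rightarrow> 'n symbol \<Rightarrow> bool" where
  "facet \<tau> \<sigma> \<longleftrightarrow> (\<exists>l\<in>\<sigma>. \<tau> = \<sigma> - {l})"


section \<open>Complexes with a labelled basis\<close>

text \<open>
  A pair \<open>(B, b)\<close> of a set \<open>B\<close> of symbols and chains \<open>b \<sigma>\<close> describes the subcomplex of the Taylor
  complex with basis the elements \<open>b \<sigma>\<close>, \<open>\<sigma> \<in> B\<close>; the symbol \<open>\<sigma>\<close> is the name of the basis element
  \<open>b \<sigma>\<close> and gives its homological degree and its multidegree.  The differential is the restriction
  of the differential \<open>d\<close> of the Taylor complex.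
\<close>

type_synonym ('n, 'k) based = "'n symbol set \<times> ('n symbol \<Rightarrow> ('n, 'k) chain)"

definition taylor_based :: "'n mon list \<Rightarrow> ('n, 'k::field) based" where
  "taylor_based ls = (Pow (set ls), taylor_basis)"

definition degree_part :: "('n, 'k::field) based \<Rightarrow> nat \<Rightarrow> ('n, 'k) chain set" where
  "degree_part F j = free_mod.span (snd F ` {\<sigma> \<in> fst F. card \<sigma> = j})"

definition free_on :: "('n, 'k::field) based \<Rightarrow> bool" where
  "free_on F \<longleftrightarrow>
     finite (fst F) \<and> inj_on (snd F) (fst F) \<and> free_mod.independent (snd F ` fst F)"

definition homogeneous :: "('n::finite) mon \<Rightarrow> ('n, 'k::field) chain \<Rightarrow> bool" where
  "homogeneous m v \<longleftrightarrow>
     (\<forall>\<sigma>. \<forall>t\<in>Poly_Mapping.keys (Poly_Mapping.lookup v \<sigma>). t + mdeg \<sigma> = m)"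

text \<open>
  The map \<open>\<epsilon>\<close> lifts the augmentation \<open>F\<^sub>0 \<rightarrow> S/M\<close> to a map into \<open>S\<close>, which is possible since \<open>F\<^sub>0\<close>
  is free: its composition with \<open>S \<rightarrow> S/M\<close> is onto, and has kernel the image of \<open>F\<^sub>1\<close>.
\<close>

definition multigraded_free_resolution ::
  "(('n::finite, 'k::field) chain \<Rightarrow> ('n, 'k) chain) \<Rightarrow> ('n, 'k) mpoly set
     \<Rightarrow> ('n, 'k) based \<Rightarrow> bool" where
  "multigraded_free_resolution d M F \<longleftrightarrow>
     free_on F \<and>
     module_hom smul smul d \<and>
     (\<forall>\<sigma>\<in>fst F. homogeneous (mdeg \<sigma>) (snd F \<sigma>) \<and> homogeneous (mdeg \<sigma>) (d (snd F \<sigma>))) \<and>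
     (\<forall>j. d ` degree_part F (Suc (Suc j)) = {v \<in> degree_part F (Suc j). d v = 0}) \<and>
     (\<exists>\<epsilon>. module_hom smul (*) \<epsilon> \<and>
        (\<forall>m v. v \<in> degree_part F 0 \<and> homogeneous m v \<longrightarrow> Poly_Mapping.keys (\<epsilon> v) \<subseteq> {m}) \<and>
        (\<forall>s. \<exists>v\<in>degree_part F 0. s - \<epsilon> v \<in> M) \<and>
        d ` degree_part F (Suc 0) = {v \<in> degree_part F 0. \<epsilon> v \<in> M})"

definition irrelevant_ideal :: "('n, 'k::field) mpoly set" where
  "irrelevant_ideal = ideal_generated (range (\<lambda>x. monom (var_power x 1)))"

definition minimal_free_resolution ::
  "(('n::finite, 'k::field) chain \<Rightarrow> ('n, 'k) chain) \<Rightarrow> ('n, 'k) mpoly set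
     \<Rightarrow> ('n, 'k) based \<Rightarrow> bool" where
  "minimal_free_resolution d M F \<longleftrightarrow>
     multigraded_free_resolution d M F \<and>
     (\<forall>j. d ` degree_part F (Suc j) \<subseteq>
            free_mod.span {smul p v | p v. p \<in> irrelevant_ideal \<and> v \<in> degree_part F j})"


section \<open>Standard cancellations\<close>

definition entry ::
  "(('n, 'k::field) chain \<Rightarrow> ('n, 'k) chain) \<Rightarrow> ('n, 'k) based
     \<Rightarrow> 'n symbol \<Rightarrow> 'n symbol \<Rightarrow> ('n, 'k) mpoly" where
  "entry d F \<tau> \<sigma> = free_mod.representation (snd F ` fst F) (d (snd F \<sigma>)) (snd F \<tau>)"

text \<open>
  The argument \<open>u\<close> is the inverse of the entry at \<open>\<tau>, \<sigma>\<close>.  Labels that are no longer in \<open>fst F\<close>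
  keep their chains.
\<close>

definition change_of_basis ::
  "(('n, 'k::field) chain \<Rightarrow> ('n, 'k) chain) \<Rightarrow> ('n, 'k) based
     \<Rightarrow> 'n symbol \<Rightarrow> 'n symbol \<Rightarrow> ('n, 'k) mpoly \<Rightarrow> 'n symbol \<Rightarrow> ('n, 'k) chain" where
  "change_of_basis d F \<sigma> \<tau> u = (\<lambda>\<rho>.
     if \<rho> = \<tau> then d (snd F \<sigma>)
     else if \<rho> \<in> fst F \<and> \<rho> \<noteq> \<sigma> \<and> card \<rho> = card \<sigma>
       then snd F \<rho> - smul (entry d F \<tau> \<rho> * u) (snd F \<sigma>)
     else snd F \<rho>)"

definition standard_cancellation ::
  "(('n, 'k::field) chain \<Rightarrow> ('n, 'k) chain) \<Rightarrow> ('n, 'k) based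
     \<Rightarrow> 'n symbol \<times> 'n symbol \<Rightarrow> ('n, 'k) based \<Rightarrow> bool" where
  "standard_cancellation d F p F' \<longleftrightarrow> (case p of (\<sigma>, \<tau>) \<Rightarrow>
     \<sigma> \<in> fst F \<and> \<tau> \<in> fst F \<and> card \<sigma> = Suc (card \<tau>) \<and>
     (\<exists>u. entry d F \<tau> \<sigma> * u = 1 \<and>
          F' = (fst F - {\<sigma>, \<tau>}, change_of_basis d F \<sigma> \<tau> u)))"

fun standard_cancellations ::
  "(('n, 'k::field) chain \<Rightarrow> ('n, 'k) chain) \<Rightarrow> ('n, 'k) based
     \<Rightarrow> ('n symbol \<times> 'n symbol) list \<Rightarrow> ('n, 'k) based \<Rightarrow> bool" where
  "standard_cancellations d F [] F'' \<longleftrightarrow> F'' = F"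
| "standard_cancellations d F (p # ps) F'' \<longleftrightarrow>
     (\<exists>F'. standard_cancellation d F p F' \<and> standard_cancellations d F' ps F'')"

definition disjoint_pairs :: "'a \<times> 'a \<Rightarrow> 'a \<times> 'a \<Rightarrow> bool" where
  "disjoint_pairs p q \<longleftrightarrow>
     fst p \<noteq> fst q \<and> fst p \<noteq> snd q \<and> snd p \<noteq> fst q \<and> snd p \<noteq> snd q"

definition cancellation_family ::
  "('n::finite) mon set \<Rightarrow> ('n symbol \<times> 'n symbol) set \<Rightarrow> bool" where
  "cancellation_family G A \<longleftrightarrow>
     A \<subseteq> Pow G \<times> Pow G \<and>
     (\<forall>p\<in>A. \<forall>q\<in>A. p \<noteq> q \<longrightarrow> disjoint_pairs p q) \<and>
     (\<forall>(\<sigma>, \<tau>)\<in>A. facet \<tau> \<sigma>) \<and>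
     (\<forall>(\<sigma>, \<tau>)\<in>A. mdeg \<sigma> = mdeg \<tau>)"

definition maximal_cancellation_family ::
  "('n::finite) mon set \<Rightarrow> ('n symbol \<times> 'n symbol) set \<Rightarrow> bool" where
  "maximal_cancellation_family G A \<longleftrightarrow>
     cancellation_family G A \<and> (\<forall>A'. cancellation_family G A' \<and> A \<subseteq> A' \<longrightarrow> A' = A)"


section \<open>Direct sums of complexes\<close>

definition internal_direct_sum ::
  "('n, 'k::field) chain set \<Rightarrow> 'i set \<Rightarrow> ('i \<Rightarrow> ('n, 'k) chain set) \<Rightarrow> bool" where
  "internal_direct_sum V I N \<longleftrightarrow>
     (\<forall>i\<in>I. free_mod.subspace (N i)) \<and>
     V = {\<Sum>i\<in>I. g i | g. \<forall>i\<in>I. g i \<in> N i} \<and>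
     (\<forall>g. (\<forall>i\<in>I. g i \<in> N i) \<and> (\<Sum>i\<in>I. g i) = 0 \<longrightarrow> (\<forall>i\<in>I. g i = 0))"

definition complex_direct_sum ::
  "(('n, 'k::field) chain \<Rightarrow> ('n, 'k) chain) \<Rightarrow> (nat \<Rightarrow> ('n, 'k) chain set)
     \<Rightarrow> 'i set \<Rightarrow> ('i \<Rightarrow> nat \<Rightarrow> ('n, 'k) chain set) \<Rightarrow> bool" where
  "complex_direct_sum d C I D \<longleftrightarrow>
     (\<forall>j. internal_direct_sum (C j) I (\<lambda>i. D i j)) \<and>
     (\<forall>i\<in>I. d ` D i 0 \<subseteq> {0} \<and> (\<forall>j. d ` D i (Suc j) \<subseteq> D i j))"

text \<open>
  The index \<open>None\<close> stands for the summand \<open>F\<close>, and \<open>Some (\<sigma>, \<tau>)\<close> for the complex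
  \<open>0 \<rightarrow> S[\<sigma>] \<rightarrow> S[\<tau>] \<rightarrow> 0\<close>, which is free on \<open>snd F \<sigma>\<close> and \<open>snd F \<tau>\<close>: after all cancellations \<open>snd F\<close>
  still holds the basis elements that were split off.
\<close>

definition splits_as ::
  "(('n, 'k::field) chain \<Rightarrow> ('n, 'k) chain) \<Rightarrow> ('n, 'k) based \<Rightarrow> ('n, 'k) based
     \<Rightarrow> ('n symbol \<times> 'n symbol) set \<Rightarrow> bool" where
  "splits_as d T F A \<longleftrightarrow>
     complex_direct_sum d (degree_part T) (insert None (Some ` A))
       (\<lambda>i. case i of None \<Rightarrow> degree_part F
                    | Some (\<sigma>, \<tau>) \<Rightarrow> degree_part ({\<sigma>, \<tau>}, snd F)) \<and>
     (\<forall>(\<sigma>, \<tau>)\<in>A. free_on ({\<sigma>, \<tau>}, snd F) \<and> d (snd F \<sigma>) = snd F \<tau>)"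

end

theory Submission
  imports Defs
begin

text \<open>
  Two symbols of equal multidegree contain the same dominant generators, because a dominant generator
  is visible in the multidegree (\<open>mdeg_eq_dominant_mem\<close>).  With two nondominant generators \<open>n\<^sub>1, n\<^sub>2\<close>
  the symbols of a given multidegree thus lie in one square \<open>D\<close>, \<open>D \<union> {n\<^sub>1}\<close>, \<open>D \<union> {n\<^sub>2}\<close>, \<open>D \<union> {n\<^sub>1, n\<^sub>2}\<close>,
  and the theorem rests on two properties of this square.

  Two distinct pairs of the family whose first members have the same homological degree and the same
  multidegree would share a symbol (\<open>mdeg_eq_pairs_meet\<close>), although they are disjoint.  This is why
  all cancellations can be done, in any order.  A cancellation around \<open>a\<^sub>\<tau>\<^sub>\<sigma>\<close> changes the entry at
  \<open>\<tau>', \<sigma>'\<close> by a multiple of \<open>a\<^sub>\<tau>\<^sub>'\<^sub>\<sigma> a\<^sub>\<tau>\<^sub>\<sigma>\<^sub>'\<close>, and the entries are homogeneous, so for two pairs of the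
  family this product can be nonzero only if all four multidegrees and the two homological degrees
  agree (\<open>cancel_pairs\<close>).  The entries at the pairs of the family thus keep the values \<open>\<plusminus>1\<close> that they
  have in the Taylor complex.

  Two symbols of equal multidegree in adjacent homological degrees are incident
  (\<open>mdeg_eq_imp_facet\<close>).  If two such symbols were left at the end, their pair could be added to the
  family, against its maximality.  Hence all entries that remain lie between different multidegrees,
  have no constant term, and the result is minimal (\<open>remaining_minimal\<close>).

  That the result is a resolution follows from the splitting.  A cancellation replaces a basis of
  the whole Taylor complex by another one in which \<open>0 \<rightarrow> S[\<sigma>] \<rightarrow> S[\<tau>] \<rightarrow> 0\<close> is a direct summand
  (\<open>cancel_pair\<close>), and a direct complement of acyclic summands in a resolution is a resolution
  (\<open>remaining_resolution\<close>).  The Taylor complex itself is exact because in each multidegree \<open>m\<close> that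
  lies in the ideal it is the augmented chain complex of the simplex on the generators dividing \<open>m\<close>,
  which contracts by inserting a fixed vertex (\<open>homotopy_term_identity\<close>, \<open>taylor_resolution\<close>).
\<close>

section \<open>Finite bases of free modules\<close>

text \<open>
  Independence of a family rather than of a set: the labels survive every change of basis, and
  coefficients are indexed by labels.
\<close>

definition indep_family :: "'i set \<Rightarrow> ('i \<Rightarrow> ('b \<Rightarrow>\<^sub>0 'r::comm_ring_1)) \<Rightarrow> bool" where
  "indep_family P b \<longleftrightarrow> (\<forall>c. (\<Sum>i\<in>P. smul (c i) (b i)) = 0 \<longrightarrow> (\<forall>i\<in>P. c i = 0))"

lemma indep_familyD: "indep_family P b \<Longrightarrow> (\<Sum>i\<in>P. smul (c i) (b i)) = 0 \<Longrightarrow> i \<in> P \<Longrightarrow> c i = 0"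
  by (auto simp: indep_family_def)

lemma indep_family_subset:
  assumes "indep_family P b" "Q \<subseteq> P" "finite P"
  shows "indep_family Q b"
  unfolding indep_family_def
proof (intro allI impI ballI)
  fix c i assume c: "(\<Sum>i\<in>Q. smul (c i) (b i)) = 0" and i: "i \<in> Q"
  have "(\<Sum>i\<in>P. smul (if i \<in> Q then c i else 0) (b i)) = (\<Sum>i\<in>Q. smul (c i) (b i))"
    by (rule sum.mono_neutral_cong_right) (use assms in auto)
  with c have "(\<Sum>i\<in>P. smul (if i \<in> Q then c i else 0) (b i)) = 0" by simp
  from indep_familyD[OF assms(1) this, of i] i assms(2) show "c i = 0" by auto
qed

lemma indep_family_inj_on:
  fixes b :: "'i \<Rightarrow> ('b \<Rightarrow>\<^sub>0 'r::comm_ring_1)"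
  assumes "indep_family P b" "finite P"
  shows "inj_on b P"
proof (rule inj_onI, rule ccontr)
  fix i j assume ij: "i \<in> P" "j \<in> P" "b i = b j" "i \<noteq> j"
  define c where "c = (\<lambda>k. if k = i then 1 else if k = j then - 1 else (0::'r))"
  have "(\<Sum>k\<in>P. smul (c k) (b k)) = (\<Sum>k\<in>{i,j}. smul (c k) (b k))"
    by (rule sum.mono_neutral_right) (use assms ij in \<open>auto simp: c_def\<close>)
  also have "\<dots> = 0" using ij by (simp add: c_def)
  finally have "c i = 0" using indep_familyD[OF assms(1)] ij by blast
  then show False by (simp add: c_def)
qed

lemma indep_family_independent:
  assumes "indep_family P b" "finite P"
  shows "free_mod.independent (b ` P)"
  unfolding free_mod.independent_explicit_module
proof (intro allI impI)
  fix t u v assume t: "finite t" "t \<subseteq> b ` P" "(\<Sum>v\<in>t. smul (u v) v) = 0" "v \<in> t"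
  define Q where "Q = {i\<in>P. b i \<in> t}"
  have tQ: "t = b ` Q" using t(2) by (auto simp: Q_def)
  have inj: "inj_on b Q" using indep_family_inj_on[OF assms] by (auto simp: Q_def inj_on_def)
  have "(\<Sum>i\<in>Q. smul (u (b i)) (b i)) = 0"
    using t(3) by (simp add: tQ sum.reindex[OF inj])
  moreover have "indep_family Q b" by (rule indep_family_subset[OF assms(1)]) (auto simp: Q_def assms)
  ultimately show "u v = 0" using t(4) unfolding tQ by (auto dest: indep_familyD)
qed

lemma span_family:
  assumes "finite P"
  shows "free_mod.span (b ` P) = {\<Sum>i\<in>P. smul (c i) (b i) | c. True}"
proof
  show "{\<Sum>i\<in>P. smul (c i) (b i) | c. True} \<subseteq> free_mod.span (b ` P)"
    by (auto intro!: free_mod.span_sum intro: free_mod.span_scale free_mod.span_base)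
  have "free_mod.subspace {\<Sum>i\<in>P. smul (c i) (b i) | c. True}"
  proof (rule free_mod.subspaceI)
    show "0 \<in> {\<Sum>i\<in>P. smul (c i) (b i) | c. True}"
      by (rule CollectI, rule exI[of _ "\<lambda>_. 0"]) simp
  next
    fix x y assume "x \<in> {\<Sum>i\<in>P. smul (c i) (b i) | c. True}" "y \<in> {\<Sum>i\<in>P. smul (c i) (b i) | c. True}"
    then obtain c e where "x = (\<Sum>i\<in>P. smul (c i) (b i))" "y = (\<Sum>i\<in>P. smul (e i) (b i))" by auto
    then have "x + y = (\<Sum>i\<in>P. smul (c i + e i) (b i))"
      by (simp add: free_mod.scale_left_distrib sum.distrib)
    then show "x + y \<in> {\<Sum>i\<in>P. smul (c i) (b i) | c. True}"
      by (intro CollectI exI[of _ "\<lambda>i. c i + e i"]) simp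
  next
    fix r x assume "x \<in> {\<Sum>i\<in>P. smul (c i) (b i) | c. True}"
    then obtain c where "x = (\<Sum>i\<in>P. smul (c i) (b i))" by auto
    then have "smul r x = (\<Sum>i\<in>P. smul (r * c i) (b i))"
      by (simp add: free_mod.scale_sum_right)
    then show "smul r x \<in> {\<Sum>i\<in>P. smul (c i) (b i) | c. True}"
      by (intro CollectI exI[of _ "\<lambda>i. r * c i"]) simp
  qed
  moreover have "b ` P \<subseteq> {\<Sum>i\<in>P. smul (c i) (b i) | c. True}"
  proof
    fix x assume "x \<in> b ` P"
    then obtain i where i: "i \<in> P" "x = b i" by auto
    have "(\<Sum>k\<in>P. smul (if k = i then 1 else 0) (b k)) = (\<Sum>k\<in>{i}. smul (if k = i then 1 else 0) (b k))"
      by (rule sum.mono_neutral_right) (use i assms in auto)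
    then show "x \<in> {\<Sum>i\<in>P. smul (c i) (b i) | c. True}"
      using i by (intro CollectI exI[of _ "\<lambda>k. if k = i then 1 else 0"]) simp
  qed
  ultimately show "free_mod.span (b ` P) \<subseteq> {\<Sum>i\<in>P. smul (c i) (b i) | c. True}"
    by (rule free_mod.span_minimal[rotated])
qed

lemma span_familyE:
  assumes "v \<in> free_mod.span (b ` P)" "finite P"
  obtains c where "v = (\<Sum>i\<in>P. smul (c i) (b i))"
  using assms by (auto simp: span_family)

lemma span_family_memI:
  assumes "\<And>i. i \<in> P \<Longrightarrow> c i \<noteq> 0 \<Longrightarrow> i \<in> Q"
  shows "(\<Sum>i\<in>P. smul (c i) (b i)) \<in> free_mod.span (b ` Q)"
proof (rule free_mod.span_sum)
  fix i assume "i \<in> P"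
  then show "smul (c i) (b i) \<in> free_mod.span (b ` Q)"
    using assms[of i] by (cases "c i = 0") (auto simp: free_mod.span_zero intro: free_mod.span_scale free_mod.span_base)
qed

lemma representation_family:
  assumes "indep_family P b" "finite P" "i \<in> P"
  shows "free_mod.representation (b ` P) (\<Sum>j\<in>P. smul (c j) (b j)) (b i) = c i"
proof -
  note ind = indep_family_independent[OF assms(1,2)]
  have "free_mod.representation (b ` P) (\<Sum>j\<in>P. smul (c j) (b j)) (b i)
      = (\<Sum>j\<in>P. c j * (if b i = b j then 1 else 0))"
    by (simp add: free_mod.representation_sum[OF ind] free_mod.representation_scale[OF ind]
        free_mod.representation_basis[OF ind] free_mod.span_scale free_mod.span_base)
  also have "\<dots> = (\<Sum>j\<in>{i}. c j * (if b i = b j then 1 else 0))"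
    by (rule sum.mono_neutral_right)
       (use assms indep_family_inj_on[OF assms(1,2)] in \<open>auto simp: inj_on_def\<close>)
  finally show ?thesis by simp
qed

lemma span_family_disjoint:
  assumes "indep_family P b" "finite P" "Q1 \<subseteq> P" "Q2 \<subseteq> P" "Q1 \<inter> Q2 = {}"
    and "v \<in> free_mod.span (b ` Q1)" "v \<in> free_mod.span (b ` Q2)"
  shows "v = 0"
proof -
  have fin: "finite Q1" "finite Q2" using assms by (auto intro: finite_subset)
  obtain c e where ce: "v = (\<Sum>i\<in>Q1. smul (c i) (b i))" "v = (\<Sum>i\<in>Q2. smul (e i) (b i))"
    using assms(6,7) fin by (metis span_familyE)
  have "(\<Sum>i\<in>Q1 \<union> Q2. smul (if i \<in> Q1 then c i else - e i) (b i))
      = (\<Sum>i\<in>Q1. smul (if i \<in> Q1 then c i else - e i) (b i))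
        + (\<Sum>i\<in>Q2. smul (if i \<in> Q1 then c i else - e i) (b i))"
    by (rule sum.union_disjoint) (use fin assms in auto)
  also have "(\<Sum>i\<in>Q2. smul (if i \<in> Q1 then c i else - e i) (b i)) = (\<Sum>i\<in>Q2. - smul (e i) (b i))"
    by (rule sum.cong) (use assms in auto)
  finally have "(\<Sum>i\<in>Q1 \<union> Q2. smul (if i \<in> Q1 then c i else - e i) (b i)) = 0"
    using ce by (simp add: sum_negf)
  moreover have "indep_family (Q1 \<union> Q2) b"
    by (rule indep_family_subset[OF assms(1)]) (use assms in auto)
  ultimately have "\<forall>i\<in>Q1. c i = 0" by (auto dest!: indep_familyD)
  then show ?thesis using ce(1) by simp
qed

text \<open>
  Coefficients with respect to a basis are unique and can be collected by blocks, so partitions of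
  the labels give direct sums.
\<close>

lemma internal_direct_sum_partition:
  fixes b :: "'n symbol \<Rightarrow> ('n, 'k::field) chain"
  assumes ind: "indep_family P b" and fin: "finite P" and fI: "finite I"
    and P: "P = (\<Union>i\<in>I. Q i)" and disj: "\<And>i j. i \<in> I \<Longrightarrow> j \<in> I \<Longrightarrow> i \<noteq> j \<Longrightarrow> Q i \<inter> Q j = {}"
  shows "internal_direct_sum (free_mod.span (b ` P)) I (\<lambda>i. free_mod.span (b ` Q i))"
proof -
  have QP: "Q i \<subseteq> P" if "i \<in> I" for i using that P by auto
  have finQ: "finite (Q i)" if "i \<in> I" for i using QP[OF that] fin by (rule finite_subset)
  have sumP: "(\<Sum>x\<in>P. f x) = (\<Sum>i\<in>I. \<Sum>x\<in>Q i. f x)" for f :: "'n symbol \<Rightarrow> ('n, 'k) chain"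
    unfolding P by (rule sum.UNION_disjoint) (use fI finQ disj in auto)
  show ?thesis unfolding internal_direct_sum_def
  proof (intro conjI ballI allI impI)
    show "free_mod.subspace (free_mod.span (b ` Q i))" for i by simp
    show "free_mod.span (b ` P) = {\<Sum>i\<in>I. g i | g. \<forall>i\<in>I. g i \<in> free_mod.span (b ` Q i)}"
    proof (intro subset_antisym subsetI)
      fix v assume "v \<in> free_mod.span (b ` P)"
      then obtain c where "v = (\<Sum>i\<in>P. smul (c i) (b i))" by (rule span_familyE[OF _ fin])
      then have "v = (\<Sum>i\<in>I. \<Sum>x\<in>Q i. smul (c x) (b x))" by (simp add: sumP)
      then show "v \<in> {\<Sum>i\<in>I. g i | g. \<forall>i\<in>I. g i \<in> free_mod.span (b ` Q i)}"
        by (intro CollectI exI[of _ "\<lambda>i. \<Sum>x\<in>Q i. smul (c x) (b x)"]) (auto intro: span_family_memI)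
    next
      fix v assume "v \<in> {\<Sum>i\<in>I. g i | g. \<forall>i\<in>I. g i \<in> free_mod.span (b ` Q i)}"
      then obtain g where g: "v = (\<Sum>i\<in>I. g i)" "\<And>i. i \<in> I \<Longrightarrow> g i \<in> free_mod.span (b ` Q i)" by auto
      have "g i \<in> free_mod.span (b ` P)" if "i \<in> I" for i
        using g(2)[OF that] free_mod.span_mono[of "b ` Q i" "b ` P"] QP[OF that] by (auto simp: image_mono)
      then show "v \<in> free_mod.span (b ` P)" unfolding g(1) by (rule free_mod.span_sum)
    qed
  next
    fix g i assume g: "(\<forall>i\<in>I. g i \<in> free_mod.span (b ` Q i)) \<and> (\<Sum>i\<in>I. g i) = 0" and i: "i \<in> I"
    have "g i = - (\<Sum>j\<in>I - {i}. g j)"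
      using g i fI by (simp add: sum.remove eq_neg_iff_add_eq_0)
    moreover have "- (\<Sum>j\<in>I - {i}. g j) \<in> free_mod.span (b ` (P - Q i))"
    proof (intro free_mod.span_neg free_mod.span_sum)
      fix j assume j: "j \<in> I - {i}"
      then have "Q j \<subseteq> P - Q i" using disj[of i j] i QP by auto
      then have "free_mod.span (b ` Q j) \<subseteq> free_mod.span (b ` (P - Q i))"
        by (intro free_mod.span_mono image_mono)
      then show "g j \<in> free_mod.span (b ` (P - Q i))" using g j by blast
    qed
    ultimately have 1: "g i \<in> free_mod.span (b ` (P - Q i))" by simp
    have 2: "g i \<in> free_mod.span (b ` Q i)" using g i by blast
    show "g i = 0"
      by (rule span_family_disjoint[OF ind fin QP[OF i] _ _ 2 1]) auto
  qed
qed

text \<open>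
  The change of basis in a standard cancellation is the composition of the two elementary changes
  that follow.  A single label \<open>s\<close> is subtracted from the others, and then one basis element is
  replaced by a combination in which its own coefficient is a unit.
\<close>

lemma indep_family_shear:
  assumes "indep_family P b" "finite P" "s \<in> P" "k s = 0"
  shows "indep_family P (\<lambda>i. b i - smul (k i) (b s))"
  unfolding indep_family_def
proof (intro allI impI)
  fix c assume 0: "(\<Sum>i\<in>P. smul (c i) (b i - smul (k i) (b s))) = 0"
  define e where "e = (\<lambda>i. if i = s then c s - (\<Sum>j\<in>P. c j * k j) else c i)"
  have "(\<Sum>i\<in>P. smul (c i) (b i - smul (k i) (b s)))
      = (\<Sum>i\<in>P. smul (c i) (b i)) - smul (\<Sum>j\<in>P. c j * k j) (b s)"
    by (simp add: free_mod.scale_right_diff_distrib sum_subtractf free_mod.scale_sum_left)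
  also have "\<dots> = (\<Sum>i\<in>P. smul (e i) (b i))"
    using assms(2,3) by (simp add: sum.remove[of P s] e_def free_mod.scale_left_diff_distrib)
  finally have e0: "\<forall>i\<in>P. e i = 0" using 0 assms(1) by (auto dest: indep_familyD)
  then have c0: "c i = 0" if "i \<in> P" "i \<noteq> s" for i using that by (auto simp: e_def)
  have "(\<Sum>j\<in>P. c j * k j) = 0"
    by (rule sum.neutral) (use c0 assms(4) in \<open>metis mult_zero_left mult_zero_right\<close>)
  then have "c s = 0" using e0 assms(3) by (auto simp: e_def)
  then show "\<forall>i\<in>P. c i = 0" using c0 by metis
qed

lemma span_shear:
  assumes "k s = 0" "\<And>i. i \<in> Q \<Longrightarrow> k i \<noteq> 0 \<Longrightarrow> s \<in> Q"
  shows "free_mod.span ((\<lambda>i. b i - smul (k i) (b s)) ` Q) = free_mod.span (b ` Q)"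
proof -
  let ?b = "\<lambda>i. b i - smul (k i) (b s)"
  have in1: "smul (k i) (b s) \<in> free_mod.span (b ` Q)" if "i \<in> Q" for i
    by (cases "k i = 0") (use assms(2)[OF that] in \<open>auto simp: free_mod.span_zero intro: free_mod.span_scale free_mod.span_base\<close>)
  have s: "?b s = b s" by (simp add: assms(1))
  have in2: "smul (k i) (b s) \<in> free_mod.span (?b ` Q)" if "i \<in> Q" for i
  proof (cases "k i = 0")
    case False
    then have "?b s \<in> ?b ` Q" using assms(2)[OF that] by blast
    then show ?thesis unfolding s by (intro free_mod.span_scale free_mod.span_base)
  qed (simp add: free_mod.span_zero)
  show ?thesis unfolding free_mod.span_eq
  proof (intro conjI image_subsetI)
    fix i assume i: "i \<in> Q"
    show "?b i \<in> free_mod.span (b ` Q)"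
      using i in1[OF i] by (intro free_mod.span_diff) (auto intro: free_mod.span_base)
    have "?b i + smul (k i) (b s) \<in> free_mod.span (?b ` Q)"
      using i in2[OF i] by (intro free_mod.span_add) (auto intro: free_mod.span_base)
    then show "b i \<in> free_mod.span (?b ` Q)" by simp
  qed
qed

lemma indep_family_substitute:
  assumes "indep_family P b" "finite P" "t \<in> P" "e t * u = 1"
  shows "indep_family P (b(t := \<Sum>i\<in>P. smul (e i) (b i)))"
  unfolding indep_family_def
proof (intro allI impI)
  fix c
  let ?s = "\<Sum>i\<in>P. smul (e i) (b i)"
  assume 0: "(\<Sum>i\<in>P. smul (c i) ((b(t := ?s)) i)) = 0"
  define f where "f = (\<lambda>i. if i = t then c t * e t else c i + c t * e i)"
  have "(\<Sum>i\<in>P. smul (c i) ((b(t := ?s)) i)) = smul (c t) ?s + (\<Sum>i\<in>P - {t}. smul (c i) (b i))"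
    using assms(2,3) by (simp add: sum.remove[of P t])
  also have "\<dots> = (\<Sum>i\<in>P. smul (c t * e i) (b i)) + (\<Sum>i\<in>P - {t}. smul (c i) (b i))"
    by (simp add: free_mod.scale_sum_right)
  also have "\<dots> = (\<Sum>i\<in>P. smul (f i) (b i))"
    using assms(2,3) by (simp add: sum.remove[of P t] f_def free_mod.scale_left_distrib sum.distrib)
  finally have f0: "\<forall>i\<in>P. f i = 0" using 0 assms(1) by (auto dest: indep_familyD)
  then have "c t * e t = 0" using assms(3) by (auto simp: f_def)
  then have "c t * (e t * u) = 0" by (metis mult.assoc mult_zero_left)
  then have "c t = 0" by (simp add: assms(4))
  then show "\<forall>i\<in>P. c i = 0" using f0 by (auto simp: f_def split: if_splits)
qed

lemma span_substitute:
  assumes "finite Q" "t \<in> Q" "e t * u = 1"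
  shows "free_mod.span ((b(t := \<Sum>i\<in>Q. smul (e i) (b i))) ` Q) = free_mod.span (b ` Q)"
proof -
  let ?s = "\<Sum>i\<in>Q. smul (e i) (b i)" and ?b = "b(t := \<Sum>i\<in>Q. smul (e i) (b i))"
  show ?thesis unfolding free_mod.span_eq
  proof (intro conjI image_subsetI)
    fix i assume i: "i \<in> Q"
    show "?b i \<in> free_mod.span (b ` Q)"
      using i by (cases "i = t") (auto intro: span_family_memI free_mod.span_base)
    have other: "b j \<in> free_mod.span (?b ` Q)" if "j \<in> Q" "j \<noteq> t" for j
    proof -
      have "?b j \<in> ?b ` Q" using that by blast
      then show ?thesis using that by (auto intro: free_mod.span_base)
    qed
    have "?b t \<in> ?b ` Q" using assms(2) by blast
    then have s: "?s \<in> free_mod.span (?b ` Q)" by (auto intro: free_mod.span_base)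
    have "smul (e t) (b t) = ?s - (\<Sum>j\<in>Q - {t}. smul (e j) (b j))"
      using assms by (simp add: sum.remove)
    also have "\<dots> \<in> free_mod.span (?b ` Q)"
      by (intro free_mod.span_diff s free_mod.span_sum free_mod.span_scale other) auto
    finally have "smul u (smul (e t) (b t)) \<in> free_mod.span (?b ` Q)" by (rule free_mod.span_scale)
    then have "b t \<in> free_mod.span (?b ` Q)" using assms(3) by (simp add: mult.commute)
    then show "b i \<in> free_mod.span (?b ` Q)" using other i by (cases "i = t") auto
  qed
qed

section \<open>Homogeneous chains\<close>

lemma keys_multE:
  fixes p q :: "('n, 'k::field) mpoly"
  assumes "t \<in> Poly_Mapping.keys (p * q)"
  obtains r s where "t = r + s" "r \<in> Poly_Mapping.keys p" "s \<in> Poly_Mapping.keys q"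
  using assms keys_mult[of p q] by blast

lemma homogeneous_0: "homogeneous m 0"
  by (simp add: homogeneous_def)

lemma homogeneous_add: "homogeneous m v \<Longrightarrow> homogeneous m w \<Longrightarrow> homogeneous m (v + w)"
  using keys_add by (fastforce simp: homogeneous_def lookup_add)

lemma homogeneous_diff:
  fixes v w :: "('n::finite, 'k::field) chain"
  assumes "homogeneous m v" "homogeneous m w"
  shows "homogeneous m (v - w)"
  unfolding homogeneous_def lookup_minus
proof (intro allI ballI)
  fix \<sigma> t assume "t \<in> Poly_Mapping.keys (Poly_Mapping.lookup v \<sigma> - Poly_Mapping.lookup w \<sigma>)"
  then have "t \<in> Poly_Mapping.keys (Poly_Mapping.lookup v \<sigma>) \<or> t \<in> Poly_Mapping.keys (Poly_Mapping.lookup w \<sigma>)"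
    by (auto simp: in_keys_iff lookup_minus)
  then show "t + mdeg \<sigma> = m" using assms by (auto simp: homogeneous_def)
qed

lemma homogeneous_sum: "(\<And>i. i \<in> I \<Longrightarrow> homogeneous m (f i)) \<Longrightarrow> homogeneous m (sum f I)"
  by (induction I rule: infinite_finite_induct) (auto simp: homogeneous_0 homogeneous_add)

lemma homogeneous_smul:
  assumes "homogeneous m' v" "\<And>t. t \<in> Poly_Mapping.keys p \<Longrightarrow> t + m' = m"
  shows "homogeneous m (smul p v)"
  unfolding homogeneous_def lookup_smul
proof (intro allI ballI)
  fix \<sigma> t assume "t \<in> Poly_Mapping.keys (p * Poly_Mapping.lookup v \<sigma>)"
  then obtain r s where rs: "t = r + s" "r \<in> Poly_Mapping.keys p" "s \<in> Poly_Mapping.keys (Poly_Mapping.lookup v \<sigma>)"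
    by (rule keys_multE)
  then have "s + mdeg \<sigma> = m'" using assms(1) by (simp add: homogeneous_def)
  then show "t + mdeg \<sigma> = m" using assms(2)[OF rs(2)] rs(1) by (simp add: add.assoc)
qed

lemma mon_add_eq_self:
  fixes t s m :: "'n mon"
  assumes "t + (s + m) = m"
  shows "t = 0" "s = 0"
proof -
  have "Poly_Mapping.lookup t x + (Poly_Mapping.lookup s x + Poly_Mapping.lookup m x) = Poly_Mapping.lookup m x" for x
    using assms by (metis lookup_add)
  then show "t = 0" "s = 0" by (auto intro!: poly_mapping_eqI)
qed


section \<open>Cancelling several pairs\<close>

text \<open>
  What holds after the pairs in \<open>R\<close> have been cancelled.  The cancelled labels keep their chains, so
  \<open>snd F\<close> is a basis of the whole complex on \<open>P\<close>, and \<open>a\<close> is the matrix of \<open>d\<close> on the part that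
  remains.  Its entries are homogeneous and vanish unless the homological degrees fit.
\<close>

locale split_stage =
  fixes d :: "('n::finite, 'k::field) chain \<Rightarrow> ('n, 'k) chain"
    and P :: "'n symbol set"
    and R :: "('n symbol \<times> 'n symbol) set"
    and F :: "('n, 'k) based"
    and a :: "'n symbol \<Rightarrow> 'n symbol \<Rightarrow> ('n, 'k) mpoly"
  assumes hom: "module_hom smul smul d"
    and fin: "finite P"
    and labels: "fst F = P - (fst ` R \<union> snd ` R)"
    and cancelled_labels: "fst ` R \<union> snd ` R \<subseteq> P"
    and indep: "indep_family P (snd F)"
    and spans: "\<And>j. free_mod.span (snd F ` {\<rho>\<in>P. card \<rho> = j})
                   = free_mod.span (taylor_basis ` {\<rho>\<in>P. card \<rho> = j})"
    and homog: "\<And>\<rho>. \<rho> \<in> P \<Longrightarrow> homogeneous (mdeg \<rho>) (snd F \<rho>)"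
    and dd: "\<And>\<rho>. \<rho> \<in> P \<Longrightarrow> d (d (snd F \<rho>)) = 0"
    and matrix: "\<And>\<rho>. \<rho> \<in> fst F \<Longrightarrow> d (snd F \<rho>) = (\<Sum>\<pi>\<in>fst F. smul (a \<pi> \<rho>) (snd F \<pi>))"
    and matrix_card: "\<And>\<pi> \<rho>. a \<pi> \<rho> \<noteq> 0 \<Longrightarrow> card \<rho> = Suc (card \<pi>)"
    and matrix_mdeg: "\<And>\<pi> \<rho> t. t \<in> Poly_Mapping.keys (a \<pi> \<rho>) \<Longrightarrow> t + mdeg \<pi> = mdeg \<rho>"
    and cancelled_card: "\<And>\<sigma> \<tau>. (\<sigma>, \<tau>) \<in> R \<Longrightarrow> card \<sigma> = Suc (card \<tau>)"
    and cancelled: "\<And>\<sigma> \<tau>. (\<sigma>, \<tau>) \<in> R \<Longrightarrow> d (snd F \<sigma>) = snd F \<tau>"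
begin

lemma remaining_subset: "fst F \<subseteq> P"
  using labels by blast

lemma remaining_finite: "finite (fst F)"
  using remaining_subset fin by (rule finite_subset)

lemma remaining_indep: "indep_family (fst F) (snd F)"
  by (rule indep_family_subset[OF indep remaining_subset fin])

lemma matrix_entry:
  assumes "\<pi> \<in> fst F" "\<rho> \<in> fst F"
  shows "entry d F \<pi> \<rho> = a \<pi> \<rho>"
  unfolding entry_def matrix[OF assms(2)]
  by (rule representation_family[OF remaining_indep remaining_finite assms(1)])

text \<open>
  The relation \<open>d \<circ> d = 0\<close> in coordinates.  The chain \<open>v\<close> is arbitrary so that it can be a chain of
  the new basis, whose differential is still expanded in the old one.
\<close>

lemma matrix_mult_zero:
  assumes \<tau>: "\<tau> \<in> fst F" and v: "d (d v) = 0" and dv: "d v = (\<Sum>\<pi>\<in>fst F. smul (c \<pi>) (snd F \<pi>))"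
  shows "(\<Sum>\<pi>\<in>fst F. c \<pi> * a \<tau> \<pi>) = 0"
proof -
  interpret module_hom smul smul d by (rule hom)
  have "0 = (\<Sum>\<pi>\<in>fst F. smul (c \<pi>) (d (snd F \<pi>)))"
    using v unfolding dv by (simp add: sum scale)
  also have "\<dots> = (\<Sum>\<pi>\<in>fst F. \<Sum>\<kappa>\<in>fst F. smul (c \<pi> * a \<kappa> \<pi>) (snd F \<kappa>))"
    by (intro sum.cong) (auto simp: matrix free_mod.scale_sum_right)
  also have "\<dots> = (\<Sum>\<kappa>\<in>fst F. smul (\<Sum>\<pi>\<in>fst F. c \<pi> * a \<kappa> \<pi>) (snd F \<kappa>))"
    by (subst sum.swap) (simp add: free_mod.scale_sum_left)
  finally have "(\<Sum>\<kappa>\<in>fst F. smul (\<Sum>\<pi>\<in>fst F. c \<pi> * a \<kappa> \<pi>) (snd F \<kappa>)) = 0" by (rule sym)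
  from indep_familyD[OF remaining_indep this \<tau>] show ?thesis .
qed

text \<open>
  One cancellation.  The new matrix is the Schur complement of the invertible entry.  Let \<open>b\<close> be the
  old and \<open>b'\<close> the new basis.  That the chains \<open>b' \<rho>\<close> with \<open>\<rho> \<noteq> \<sigma>, \<tau>\<close> span a subcomplex is a consequence
  of \<open>d \<circ> d = 0\<close>: up to the unit \<open>a \<tau> \<sigma>\<close>, the coefficient of \<open>b' \<sigma>\<close> in the new expansion of
  \<open>d (b' \<rho>)\<close> is the coefficient of \<open>b \<tau>\<close> in \<open>d (d (b' \<rho>))\<close>.  The coefficient of \<open>b' \<tau>\<close> vanishes by the
  choice of \<open>b' \<rho>\<close>.
\<close>

lemma cancel_pair:
  assumes \<sigma>: "\<sigma> \<in> fst F" and \<tau>: "\<tau> \<in> fst F" and c: "a \<tau> \<sigma> = Poly_Mapping.single 0 c" "c \<noteq> 0"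
  shows "\<exists>F'. standard_cancellation d F (\<sigma>, \<tau>) F' \<and>
    split_stage d P (insert (\<sigma>, \<tau>) R) F'
      (\<lambda>\<pi> \<rho>. a \<pi> \<rho> - a \<pi> \<sigma> * Poly_Mapping.single 0 (inverse c) * a \<tau> \<rho>)"
proof -
  interpret dh: module_hom smul smul d by (rule hom)
  define u :: "('n, 'k) mpoly" where "u = Poly_Mapping.single 0 (inverse c)"
  define a' where "a' = (\<lambda>\<pi> \<rho>. a \<pi> \<rho> - a \<pi> \<sigma> * u * a \<tau> \<rho>)"
  define b where "b = snd F"
  define B where "B = fst F"
  define b' where "b' = change_of_basis d F \<sigma> \<tau> u"
  define B' where "B' = B - {\<sigma>, \<tau>}"
  have u: "a \<tau> \<sigma> * u = 1" unfolding c u_def by (simp add: mult_single c(2))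
  have a_ne: "a \<tau> \<sigma> \<noteq> 0" using u by auto
  have card: "card \<sigma> = Suc (card \<tau>)" by (rule matrix_card[OF a_ne])
  then have ne: "\<sigma> \<noteq> \<tau>" by auto
  have mdeg: "mdeg \<sigma> = mdeg \<tau>" using matrix_mdeg[of 0 \<tau> \<sigma>] c by simp
  have a_diag: "a \<rho> \<rho> = 0" for \<rho> using matrix_card[of \<rho> \<rho>] by auto
  have \<sigma>P: "\<sigma> \<in> P" and \<tau>P: "\<tau> \<in> P" using \<sigma> \<tau> remaining_subset by auto
  have finB: "finite B" unfolding B_def by (rule remaining_finite)
  have b'_\<tau>: "b' \<tau> = d (b \<sigma>)" by (simp add: b'_def change_of_basis_def b_def)
  have b'_\<sigma>: "b' \<sigma> = b \<sigma>" using ne by (simp add: b'_def change_of_basis_def b_def)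
  have b'_old: "b' \<rho> = b \<rho>" if "\<rho> \<notin> B" for \<rho>
    using that \<tau> by (auto simp: b'_def change_of_basis_def b_def B_def)
  have b'_B': "b' \<rho> = b \<rho> - smul (a \<tau> \<rho> * u) (b \<sigma>)" if "\<rho> \<in> B'" for \<rho>
  proof (cases "card \<rho> = card \<sigma>")
    case True
    then show ?thesis using that matrix_entry[OF \<tau>, of \<rho>]
      by (simp add: b'_def change_of_basis_def b_def B_def B'_def)
  next
    case False
    then have "a \<tau> \<rho> = 0" using matrix_card[of \<tau> \<rho>] card by auto
    then show ?thesis using that False by (simp add: b'_def change_of_basis_def b_def B_def B'_def)
  qed
  have bm: "d (b \<rho>) = (\<Sum>\<pi>\<in>B. smul (a \<pi> \<rho>) (b \<pi>))" if "\<rho> \<in> B" for \<rho>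
    using matrix that by (simp add: b_def B_def)
  have B_split: "(\<Sum>\<pi>\<in>B. f \<pi>) = f \<sigma> + (f \<tau> + (\<Sum>\<pi>\<in>B'. f \<pi>))" for f :: "_ \<Rightarrow> 'x::comm_monoid_add"
  proof -
    have "B = insert \<sigma> (insert \<tau> B')" using \<sigma> \<tau> by (auto simp: B_def B'_def)
    then have "(\<Sum>\<pi>\<in>B. f \<pi>) = (\<Sum>\<pi>\<in>insert \<sigma> (insert \<tau> B'). f \<pi>)" by (rule arg_cong)
    also have "\<dots> = f \<sigma> + (f \<tau> + (\<Sum>\<pi>\<in>B'. f \<pi>))" using ne finB by (simp add: B'_def)
    finally show ?thesis .
  qed
  have dd': "d (d (b' \<rho>)) = 0" if "\<rho> \<in> P" for \<rho>
  proof -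
    have "b' \<rho> = b \<rho> - smul (a \<tau> \<rho> * u) (b \<sigma>)" if "\<rho> \<in> B'" using b'_B' that .
    moreover have "\<rho> = \<tau> \<or> \<rho> = \<sigma> \<or> \<rho> \<in> B' \<or> \<rho> \<notin> B" by (auto simp: B'_def)
    moreover have "d (d (b \<rho>)) = 0" "d (d (b \<sigma>)) = 0" using dd that \<sigma>P by (simp_all add: b_def)
    ultimately show ?thesis using b'_\<tau> b'_\<sigma> b'_old by (auto simp: dh.diff dh.scale)
  qed
  have a'_\<tau>: "a' \<tau> \<rho> = 0" for \<rho> by (simp add: a'_def u)
  have a'_\<sigma>: "a' \<sigma> \<rho> = a \<sigma> \<rho>" for \<rho> by (simp add: a'_def a_diag)
  have matrix': "d (b' \<rho>) = (\<Sum>\<pi>\<in>B'. smul (a' \<pi> \<rho>) (b' \<pi>))" if \<rho>: "\<rho> \<in> B'" for \<rho>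
  proof -
    have \<rho>B: "\<rho> \<in> B" using \<rho> by (simp add: B'_def)
    have "d (b' \<rho>) = d (b \<rho>) - smul (a \<tau> \<rho> * u) (d (b \<sigma>))"
      using b'_B'[OF \<rho>] by (simp add: dh.diff dh.scale)
    also have "\<dots> = (\<Sum>\<pi>\<in>B. smul (a' \<pi> \<rho>) (b \<pi>))"
      using \<rho>B \<sigma> bm by (simp add: B_def a'_def free_mod.scale_left_diff_distrib sum_subtractf
          free_mod.scale_sum_right mult_ac)
    finally have db: "d (b' \<rho>) = (\<Sum>\<pi>\<in>B. smul (a' \<pi> \<rho>) (b \<pi>))" .
    have "\<rho> \<in> P" using \<rho>B remaining_subset by (auto simp: B_def)
    then have "(\<Sum>\<pi>\<in>B. a' \<pi> \<rho> * a \<tau> \<pi>) = 0"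
      using matrix_mult_zero[OF \<tau> dd' db[unfolded B_def b_def]] by (simp add: B_def)
    then have "(a \<sigma> \<rho> * a \<tau> \<sigma> + (\<Sum>\<pi>\<in>B'. a' \<pi> \<rho> * a \<tau> \<pi>)) * u = 0"
      by (simp add: B_split a_diag a'_\<sigma>)
    then have *: "a \<sigma> \<rho> + (\<Sum>\<pi>\<in>B'. a' \<pi> \<rho> * (a \<tau> \<pi> * u)) = 0"
      using u by (simp add: distrib_right sum_distrib_right mult.assoc)
    have **: "(\<Sum>\<pi>\<in>B'. a' \<pi> \<rho> * (a \<tau> \<pi> * u)) = - a \<sigma> \<rho>"
      by (rule minus_unique[OF *, symmetric])
    have "(\<Sum>\<pi>\<in>B'. smul (a' \<pi> \<rho>) (b' \<pi>))
        = (\<Sum>\<pi>\<in>B'. smul (a' \<pi> \<rho>) (b \<pi>)) - smul (\<Sum>\<pi>\<in>B'. a' \<pi> \<rho> * (a \<tau> \<pi> * u)) (b \<sigma>)"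
      by (simp add: b'_B' free_mod.scale_right_diff_distrib sum_subtractf free_mod.scale_sum_left)
    also have "\<dots> = (\<Sum>\<pi>\<in>B'. smul (a' \<pi> \<rho>) (b \<pi>)) + smul (a \<sigma> \<rho>) (b \<sigma>)"
      unfolding ** by simp
    also have "\<dots> = (\<Sum>\<pi>\<in>B. smul (a' \<pi> \<rho>) (b \<pi>))"
      by (simp add: B_split a'_\<tau> a'_\<sigma> add.commute)
    finally show ?thesis using db by simp
  qed
  define k where "k = (\<lambda>\<rho>. if \<rho> \<in> B' then a \<tau> \<rho> * u else 0)"
  define e where "e = (\<lambda>\<pi>. if \<pi> \<in> B then a \<pi> \<sigma> else 0)"
  let ?b1 = "\<lambda>\<rho>. b \<rho> - smul (k \<rho>) (b \<sigma>)"
  have k\<sigma>: "k \<sigma> = 0" by (simp add: k_def B'_def)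
  have e\<tau>: "e \<tau> * u = 1" using \<tau> u by (simp add: e_def B_def)
  \<comment> \<open>The two elementary changes do not interfere, because they act in different homological degrees.\<close>
  have ek: "e \<pi> \<noteq> 0 \<Longrightarrow> k \<pi> = 0" for \<pi>
    using matrix_card[of \<pi> \<sigma>] matrix_card[of \<tau> \<pi>] card
    by (cases "a \<tau> \<pi> = 0") (auto simp: e_def k_def split: if_splits)
  have b'_b1: "b' \<rho> = (?b1(\<tau> := \<Sum>\<pi>\<in>Q. smul (e \<pi>) (?b1 \<pi>))) \<rho>"
    if Q: "Q \<subseteq> P" "\<And>\<pi>. \<pi> \<in> P \<Longrightarrow> card \<pi> = card \<tau> \<Longrightarrow> \<pi> \<in> Q" for Q \<rho>
  proof (cases "\<rho> = \<tau>")
    case True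
    have "smul (e \<pi>) (?b1 \<pi>) = smul (e \<pi>) (b \<pi>)" for \<pi> using ek[of \<pi>] by (cases "e \<pi> = 0") auto
    then have "(\<Sum>\<pi>\<in>Q. smul (e \<pi>) (?b1 \<pi>)) = (\<Sum>\<pi>\<in>Q. smul (e \<pi>) (b \<pi>))" by simp
    also have "\<dots> = (\<Sum>\<pi>\<in>P. smul (e \<pi>) (b \<pi>))"
    proof (rule sum.mono_neutral_left[OF fin Q(1)], rule ballI)
      fix \<pi> assume "\<pi> \<in> P - Q"
      then have "a \<pi> \<sigma> = 0" using Q(2)[of \<pi>] matrix_card[of \<pi> \<sigma>] card by (cases "a \<pi> \<sigma> = 0") auto
      then have "e \<pi> = 0" by (simp add: e_def)
      then show "smul (e \<pi>) (b \<pi>) = 0" by simp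
    qed
    also have "\<dots> = (\<Sum>\<pi>\<in>B. smul (a \<pi> \<sigma>) (b \<pi>))"
      by (rule sum.mono_neutral_cong_right[OF fin]) (use remaining_subset in \<open>auto simp: e_def B_def\<close>)
    also have "\<dots> = d (b \<sigma>)" using bm[of \<sigma>] \<sigma> by (simp add: B_def)
    finally show ?thesis using True b'_\<tau> by simp
  next
    case False
    then show ?thesis
      using b'_B'[of \<rho>] b'_\<sigma> b'_old[of \<rho>] k\<sigma> by (cases "\<rho> = \<sigma>"; cases "\<rho> \<in> B") (auto simp: k_def B'_def)
  qed
  have indep_b: "indep_family P b" using indep by (simp add: b_def)
  have b'_eq: "b' = ?b1(\<tau> := \<Sum>\<pi>\<in>P. smul (e \<pi>) (?b1 \<pi>))" by (rule ext, rule b'_b1) auto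
  have indep': "indep_family P b'"
    unfolding b'_eq
    by (rule indep_family_substitute) (auto intro: indep_family_shear indep_b fin \<sigma>P \<tau>P k\<sigma> e\<tau>)
  have spans': "free_mod.span (b' ` {\<rho>\<in>P. card \<rho> = j}) = free_mod.span (taylor_basis ` {\<rho>\<in>P. card \<rho> = j})" for j
  proof -
    let ?Q = "{\<rho>\<in>P. card \<rho> = j}"
    have "free_mod.span (b' ` ?Q) = free_mod.span (?b1 ` ?Q)"
    proof (cases "j = card \<tau>")
      case True
      have "b' = ?b1(\<tau> := \<Sum>\<pi>\<in>?Q. smul (e \<pi>) (?b1 \<pi>))" by (rule ext, rule b'_b1) (use True in auto)
      moreover have "\<tau> \<in> ?Q" "finite ?Q" using True \<tau>P fin by auto
      ultimately show ?thesis using span_substitute[of ?Q \<tau> e u ?b1] e\<tau> by simp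
    next
      case False
      have "b' \<rho> = ?b1 \<rho>" if "\<rho> \<in> ?Q" for \<rho>
        using b'_b1[of P \<rho>] False that by auto
      then show ?thesis by (metis (no_types, lifting) image_cong)
    qed
    also have "\<dots> = free_mod.span (b ` ?Q)"
    proof (rule span_shear[where k = k, OF k\<sigma>])
      fix \<rho> assume "\<rho> \<in> ?Q" "k \<rho> \<noteq> 0"
      then have "a \<tau> \<rho> \<noteq> 0" "card \<rho> = j" by (auto simp: k_def split: if_splits)
      then show "\<sigma> \<in> ?Q" using matrix_card[of \<tau> \<rho>] card \<sigma>P by simp
    qed
    finally show ?thesis using spans by (simp add: b_def)
  qed
  have keys_u: "r \<in> Poly_Mapping.keys (p * u) \<Longrightarrow> r \<in> Poly_Mapping.keys p" for r p
    by (erule keys_multE) (auto simp: u_def split: if_splits)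
  have matrix_mdeg_prod: "t + mdeg \<pi> = mdeg \<rho>"
    if t: "t \<in> Poly_Mapping.keys (a \<pi> \<sigma> * u * a \<tau> \<rho>)" for t \<pi> \<rho>
  proof -
    obtain r s where rs: "t = r + s" "r \<in> Poly_Mapping.keys (a \<pi> \<sigma> * u)" "s \<in> Poly_Mapping.keys (a \<tau> \<rho>)"
      using t by (rule keys_multE)
    have "r + mdeg \<pi> = mdeg \<sigma>" using keys_u[OF rs(2)] by (rule matrix_mdeg)
    moreover have "s + mdeg \<tau> = mdeg \<rho>" using rs(3) by (rule matrix_mdeg)
    ultimately show ?thesis using mdeg rs(1) by (metis add.assoc add.commute)
  qed
  have homog': "homogeneous (mdeg \<rho>) (b' \<rho>)" if "\<rho> \<in> P" for \<rho>
  proof -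
    have 1: "homogeneous (mdeg \<rho>) (b \<rho>)" if "\<rho> \<in> P" for \<rho> using homog that by (simp add: b_def)
    have "homogeneous (mdeg \<tau>) (d (b \<sigma>))"
      unfolding bm[of \<sigma>, unfolded B_def, OF \<sigma>]
      by (intro homogeneous_sum, rule homogeneous_smul[OF 1])
         (use remaining_subset matrix_mdeg mdeg in \<open>auto\<close>)
    moreover have "homogeneous (mdeg \<rho>) (b \<rho> - smul (a \<tau> \<rho> * u) (b \<sigma>))"
    proof (intro homogeneous_diff 1[OF that] homogeneous_smul[OF 1[OF \<sigma>P]])
      fix t assume "t \<in> Poly_Mapping.keys (a \<tau> \<rho> * u)"
      then show "t + mdeg \<sigma> = mdeg \<rho>" unfolding mdeg by (rule matrix_mdeg[OF keys_u])
    qed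
    moreover have "\<rho> = \<tau> \<or> \<rho> = \<sigma> \<or> \<rho> \<in> B' \<or> \<rho> \<notin> B" by (auto simp: B'_def)
    ultimately show ?thesis using 1[OF that] b'_\<tau> b'_\<sigma> b'_old[of \<rho>] b'_B'[of \<rho>] by auto
  qed
  have "split_stage d P (insert (\<sigma>, \<tau>) R) (B', b') a'"
  proof (unfold_locales, goal_cases)
    case 1 show ?case by (rule fin)
  next
    case 2 show ?case using labels by (auto simp: B'_def B_def)
  next
    case 3 show ?case using cancelled_labels \<sigma>P \<tau>P by auto
  next
    case 4 show ?case using indep' by simp
  next
    case (5 j) show ?case using spans' by simp
  next
    case (6 \<rho>) then show ?case using homog' by simp
  next
    case (7 \<rho>) then show ?case using dd' by simp
  next
    case (8 \<rho>) then show ?case using matrix' by simp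
  next
    case (9 \<pi> \<rho>)
    then have "a \<pi> \<rho> \<noteq> 0 \<or> a \<pi> \<sigma> \<noteq> 0 \<and> a \<tau> \<rho> \<noteq> 0" by (auto simp: a'_def)
    then show ?case using matrix_card[of \<pi> \<rho>] matrix_card[of \<pi> \<sigma>] matrix_card[of \<tau> \<rho>] card by auto
  next
    case (10 \<pi> \<rho> t)
    then have "t \<in> Poly_Mapping.keys (a \<pi> \<rho>) \<or> t \<in> Poly_Mapping.keys (a \<pi> \<sigma> * u * a \<tau> \<rho>)"
      by (auto simp: a'_def in_keys_iff lookup_minus)
    then show ?case using matrix_mdeg matrix_mdeg_prod by blast
  next
    case (11 \<sigma>' \<tau>') then show ?case using cancelled_card card by auto
  next
    case (12 \<sigma>' \<tau>')
    show ?case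
    proof (cases "(\<sigma>', \<tau>') = (\<sigma>, \<tau>)")
      case True then show ?thesis using b'_\<tau> b'_\<sigma> by simp
    next
      case False
      then have R: "(\<sigma>', \<tau>') \<in> R" using 12 by auto
      then have "\<sigma>' \<notin> B" "\<tau>' \<notin> B" using labels by (force simp: B_def)+
      then show ?thesis using cancelled[OF R] b'_old by (simp add: b_def)
    qed
  qed
  moreover have "standard_cancellation d F (\<sigma>, \<tau>) (B', b')"
    unfolding standard_cancellation_def using \<sigma> \<tau> card u matrix_entry[OF \<tau> \<sigma>]
    by (auto simp: B'_def B_def b'_def)
  ultimately show ?thesis unfolding a'_def u_def by blast
qed

end

text \<open>
  A pending pair survives the cancellation of another one.  A change of the entry of \<open>(\<sigma>', \<tau>')\<close> needs
  two nonzero entries, which give \<open>mdeg \<tau>\<close> dividing \<open>mdeg \<sigma>'\<close> and \<open>mdeg \<tau>'\<close> dividing \<open>mdeg \<sigma>\<close>; as the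
  members of a pair have equal multidegree, all four multidegrees would coincide.  The last
  hypothesis excludes this when the homological degrees agree, and otherwise one of the two entries
  vanishes for reasons of degree.  The order of the pairs in the list is therefore irrelevant.
\<close>

lemma cancel_pairs:
  assumes "split_stage d P R F a" and "distinct qs"
    and "\<And>\<sigma> \<tau>. (\<sigma>, \<tau>) \<in> set qs \<Longrightarrow> \<sigma> \<in> fst F \<and> \<tau> \<in> fst F \<and> mdeg \<sigma> = mdeg \<tau> \<and>
            (\<exists>c. c \<noteq> 0 \<and> a \<tau> \<sigma> = Poly_Mapping.single 0 c)"
    and "\<And>p q. p \<in> set qs \<Longrightarrow> q \<in> set qs \<Longrightarrow> p \<noteq> q \<Longrightarrow> disjoint_pairs p q"
    and "\<And>p q. p \<in> set qs \<Longrightarrow> q \<in> set qs \<Longrightarrow> p \<noteq> q \<Longrightarrow> card (fst p) = card (fst q) \<Longrightarrow>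
            mdeg (fst p) \<noteq> mdeg (fst q)"
  shows "\<exists>F' a'. standard_cancellations d F qs F' \<and> split_stage d P (R \<union> set qs) F' a'"
  using assms
proof (induction qs arbitrary: R F a)
  case Nil
  then show ?case by auto
next
  case (Cons p qs)
  obtain \<sigma> \<tau> where p: "p = (\<sigma>, \<tau>)" by (cases p)
  interpret split_stage d P R F a by (rule Cons.prems)
  have \<sigma>\<tau>: "\<sigma> \<in> fst F" "\<tau> \<in> fst F" "mdeg \<sigma> = mdeg \<tau>" using Cons.prems(3)[of \<sigma> \<tau>] p by auto
  obtain c where c: "a \<tau> \<sigma> = Poly_Mapping.single 0 c" "c \<noteq> 0" using Cons.prems(3)[of \<sigma> \<tau>] p by auto
  define a' where "a' = (\<lambda>\<pi> \<rho>. a \<pi> \<rho> - a \<pi> \<sigma> * Poly_Mapping.single 0 (inverse c) * a \<tau> \<rho>)"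
  obtain F' where F': "standard_cancellation d F p F'" "split_stage d P (insert p R) F' a'"
    using cancel_pair[OF \<sigma>\<tau>(1,2) c] unfolding a'_def p by blast
  have fstF': "fst F' = fst F - {\<sigma>, \<tau>}" using F'(1) by (auto simp: standard_cancellation_def p)
  have "\<exists>F'' a''. standard_cancellations d F' qs F'' \<and> split_stage d P (insert p R \<union> set qs) F'' a''"
  proof (rule Cons.IH[OF F'(2)])
    show "distinct qs" using Cons.prems by simp
  next
    fix \<sigma>' \<tau>' assume q: "(\<sigma>', \<tau>') \<in> set qs"
    then have pq: "p \<noteq> (\<sigma>', \<tau>')" using Cons.prems(2) by auto
    have disj: "disjoint_pairs p (\<sigma>', \<tau>')" using Cons.prems(4)[of p "(\<sigma>', \<tau>')"] q pq by simp
    have q': "\<sigma>' \<in> fst F" "\<tau>' \<in> fst F" "mdeg \<sigma>' = mdeg \<tau>'" using Cons.prems(3)[of \<sigma>' \<tau>'] q by auto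
    have "a \<tau>' \<sigma> = 0 \<or> a \<tau> \<sigma>' = 0"
    proof (rule ccontr)
      assume "\<not> ?thesis"
      then have ne: "a \<tau>' \<sigma> \<noteq> 0" "a \<tau> \<sigma>' \<noteq> 0" by auto
      have "Poly_Mapping.lookup (a \<tau> \<sigma>) 0 \<noteq> 0" using c by simp
      then have "a \<tau> \<sigma> \<noteq> 0" by auto
      then have card: "card \<sigma> = card \<sigma>'"
        using matrix_card[OF ne(2)] matrix_card[of \<tau> \<sigma>] by simp
      have "Poly_Mapping.keys (a \<tau>' \<sigma>) \<noteq> {}" "Poly_Mapping.keys (a \<tau> \<sigma>') \<noteq> {}" using ne by simp_all
      then obtain t s where "t \<in> Poly_Mapping.keys (a \<tau>' \<sigma>)" "s \<in> Poly_Mapping.keys (a \<tau> \<sigma>')" by blast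
      then have ts: "t + mdeg \<sigma>' = mdeg \<sigma>" "s + mdeg \<sigma> = mdeg \<sigma>'"
        using matrix_mdeg \<sigma>\<tau>(3) q'(3) by auto
      then have "t = 0" using mon_add_eq_self(1)[of t s "mdeg \<sigma>"] by simp
      then have "mdeg \<sigma> = mdeg \<sigma>'" using ts(1) by simp
      with card show False using Cons.prems(5)[of p "(\<sigma>', \<tau>')"] q pq p by auto
    qed
    then have a': "a' \<tau>' \<sigma>' = a \<tau>' \<sigma>'" by (auto simp: a'_def)
    have "\<exists>c. c \<noteq> 0 \<and> a \<tau>' \<sigma>' = Poly_Mapping.single 0 c" using Cons.prems(3)[of \<sigma>' \<tau>'] q by simp
    moreover have "\<sigma>' \<in> fst F'" "\<tau>' \<in> fst F'" using q' disj by (auto simp: fstF' p disjoint_pairs_def)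
    ultimately show "\<sigma>' \<in> fst F' \<and> \<tau>' \<in> fst F' \<and> mdeg \<sigma>' = mdeg \<tau>' \<and>
        (\<exists>c. c \<noteq> 0 \<and> a' \<tau>' \<sigma>' = Poly_Mapping.single 0 c)"
      using q'(3) by (simp add: a')
  next
    fix p' q assume "p' \<in> set qs" "q \<in> set qs" "p' \<noteq> q"
    then show "disjoint_pairs p' q" using Cons.prems(4) by simp
  next
    fix p' q assume "p' \<in> set qs" "q \<in> set qs" "p' \<noteq> q" "card (fst p') = card (fst q)"
    then show "mdeg (fst p') \<noteq> mdeg (fst q)" using Cons.prems(5) by simp
  qed
  then obtain F'' a'' where F'': "standard_cancellations d F' qs F''"
    "split_stage d P (insert p R \<union> set qs) F'' a''" by blast
  have "standard_cancellations d F (p # qs) F''"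
    unfolding standard_cancellations.simps using F'(1) F''(1) by blast
  moreover have "R \<union> set (p # qs) = insert p R \<union> set qs" by simp
  ultimately show ?case using F''(2) by (intro exI[of _ F''] exI[of _ a'']) simp
qed

section \<open>Monomials and monomial ideals\<close>

lemma mon_dvd_iff: "mon_dvd a b \<longleftrightarrow> (\<forall>x. Poly_Mapping.lookup a x \<le> Poly_Mapping.lookup b x)"
proof
  assume *: "\<forall>x. Poly_Mapping.lookup a x \<le> Poly_Mapping.lookup b x"
  have "b = a + (b - a)"
    by (rule poly_mapping_eqI) (use * in \<open>simp add: lookup_add lookup_minus\<close>)
  then show "mon_dvd a b" by (auto simp: mon_dvd_def)
qed (auto simp: mon_dvd_def lookup_add)

lemma mon_dvd_refl: "mon_dvd a a"
  by (simp add: mon_dvd_iff)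

lemma mon_dvd_trans: "mon_dvd a b \<Longrightarrow> mon_dvd b c \<Longrightarrow> mon_dvd a c"
  unfolding mon_dvd_iff by (meson order_trans)

lemma mon_dvd_antisym: "mon_dvd a b \<Longrightarrow> mon_dvd b a \<Longrightarrow> a = b"
  unfolding mon_dvd_iff by (intro poly_mapping_eqI) (meson order_antisym)

lemma mon_dvd_add: "mon_dvd a b \<Longrightarrow> mon_dvd a (c + b)"
  unfolding mon_dvd_iff by (simp add: lookup_add trans_le_add2)

lemma mon_diff_add: "mon_dvd a b \<Longrightarrow> b - a + a = b"
  unfolding mon_dvd_iff by (intro poly_mapping_eqI) (simp add: lookup_add lookup_minus)

lemma var_power_dvd: "mon_dvd (var_power x k) m \<longleftrightarrow> k \<le> Poly_Mapping.lookup m x"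
  unfolding mon_dvd_iff var_power_def by (auto simp: lookup_single when_def)

lemma lookup_mdeg_le_iff:
  "finite \<sigma> \<Longrightarrow> Poly_Mapping.lookup (mdeg \<sigma>) x \<le> n \<longleftrightarrow> (\<forall>l\<in>\<sigma>. Poly_Mapping.lookup l x \<le> n)"
  by (simp add: lookup_mdeg)

lemma le_lookup_mdeg_iff:
  "finite \<sigma> \<Longrightarrow> k \<ge> 1 \<Longrightarrow> k \<le> Poly_Mapping.lookup (mdeg \<sigma>) x \<longleftrightarrow> (\<exists>l\<in>\<sigma>. k \<le> Poly_Mapping.lookup l x)"
  by (subst lookup_mdeg, subst Max_ge_iff) auto

lemma mdeg_dvd_iff: "finite \<sigma> \<Longrightarrow> mon_dvd (mdeg \<sigma>) m \<longleftrightarrow> (\<forall>l\<in>\<sigma>. mon_dvd l m)"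
  unfolding mon_dvd_iff by (auto simp: lookup_mdeg_le_iff)

lemma mdeg_mono: "finite \<sigma> \<Longrightarrow> \<tau> \<subseteq> \<sigma> \<Longrightarrow> mon_dvd (mdeg \<tau>) (mdeg \<sigma>)"
  using mdeg_dvd_iff[of \<sigma> "mdeg \<sigma>"] by (auto simp: mdeg_dvd_iff finite_subset mon_dvd_refl)

lemma mdeg_empty [simp]: "mdeg {} = 0"
  by (rule poly_mapping_eqI) (simp add: lookup_mdeg)

lemma poly_expansion: "p = (\<Sum>t\<in>Poly_Mapping.keys p. Poly_Mapping.single t (Poly_Mapping.lookup p t))"
proof (rule poly_mapping_eqI)
  fix s
  have "Poly_Mapping.lookup p s
      = (\<Sum>t\<in>Poly_Mapping.keys p. if t = s then Poly_Mapping.lookup p t else 0)"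
    by (simp add: in_keys_iff)
  then show "Poly_Mapping.lookup p s
      = Poly_Mapping.lookup (\<Sum>t\<in>Poly_Mapping.keys p. Poly_Mapping.single t (Poly_Mapping.lookup p t)) s"
    by (simp add: lookup_sum lookup_single when_def)
qed

lemma ideal_generated_monoms:
  fixes G :: "'n mon set"
  shows "ideal_generated (monom ` G :: ('n, 'k::field) mpoly set)
       = {p. \<forall>t\<in>Poly_Mapping.keys p. \<exists>l\<in>G. mon_dvd l t}" (is "_ = ?I")
proof
  interpret R: module "(*) :: ('n, 'k) mpoly \<Rightarrow> ('n, 'k) mpoly \<Rightarrow> ('n, 'k) mpoly" by (rule module_ring)
  show "ideal_generated (monom ` G) \<subseteq> ?I" unfolding ideal_generated_def
  proof (rule R.span_minimal)
    show "monom ` G \<subseteq> ?I" by (auto simp: monom_def intro: mon_dvd_refl)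
    show "R.subspace ?I"
    proof (rule R.subspaceI)
      fix p q :: "('n, 'k) mpoly" assume "p \<in> ?I" "q \<in> ?I"
      then show "p + q \<in> ?I" using keys_add[of p q] by blast
    next
      fix c p :: "('n, 'k) mpoly" assume p: "p \<in> ?I"
      show "c * p \<in> ?I"
      proof (intro CollectI ballI)
        fix t assume "t \<in> Poly_Mapping.keys (c * p)"
        then obtain r s where "t = r + s" "s \<in> Poly_Mapping.keys p" by (rule keys_multE)
        then show "\<exists>l\<in>G. mon_dvd l t" using p by (auto intro: mon_dvd_add)
      qed
    qed simp
  qed
  show "?I \<subseteq> ideal_generated (monom ` G)"
  proof
    fix p :: "('n, 'k) mpoly" assume p: "p \<in> ?I"
    have "Poly_Mapping.single t c \<in> R.span (monom ` G)" if t: "t \<in> Poly_Mapping.keys p" for t c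
    proof -
      obtain l where l: "l \<in> G" "mon_dvd l t" using p t by auto
      have "Poly_Mapping.single t c = Poly_Mapping.single (t - l) c * monom l"
        by (simp add: monom_def mult_single mon_diff_add[OF l(2)])
      also have "\<dots> \<in> R.span (monom ` G)" using l(1) by (intro R.span_scale R.span_base) auto
      finally show ?thesis .
    qed
    then show "p \<in> ideal_generated (monom ` G)" unfolding ideal_generated_def
      by (subst poly_expansion) (intro R.span_sum)
  qed
qed

lemma monom_mem_ideal:
  "(monom m :: ('n, 'k::field) mpoly) \<in> ideal_generated (monom ` G) \<longleftrightarrow> (\<exists>l\<in>G. mon_dvd l m)"
  unfolding ideal_generated_monoms by (simp add: monom_def)

lemma minimal_generators_incomparable:
  fixes M :: "('n, 'k::field) mpoly set"
  assumes G: "minimal_generating_set M G" and "l \<in> G" "l' \<in> G" "mon_dvd l l'"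
  shows "l = l'"
proof (rule ccontr)
  assume "l \<noteq> l'"
  then have "(\<exists>g\<in>G - {l'}. mon_dvd g t) \<longleftrightarrow> (\<exists>g\<in>G. mon_dvd g t)" for t
    using assms(2-4) by (metis Diff_iff mon_dvd_trans singletonD)
  then have "ideal_generated (monom ` (G - {l'})) = M"
    using G by (simp add: minimal_generating_set_def ideal_generated_monoms)
  moreover have "G - {l'} \<subset> G" using assms(3) by blast
  ultimately show False using G by (auto simp: minimal_generating_set_def)
qed

lemma minimal_generating_set_subset:
  fixes M :: "('n, 'k::field) mpoly set"
  assumes G: "minimal_generating_set M G" and H: "minimal_generating_set M H"
  shows "G \<subseteq> H"
proof
  fix g assume g: "g \<in> G"
  have GM: "ideal_generated (monom ` G) = M" and HM: "ideal_generated (monom ` H) = M"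
    using G H by (simp_all add: minimal_generating_set_def)
  have "(monom g :: ('n, 'k) mpoly) \<in> ideal_generated (monom ` G)"
    unfolding monom_mem_ideal using g mon_dvd_refl by blast
  then obtain h where h: "h \<in> H" "mon_dvd h g" unfolding GM HM[symmetric] monom_mem_ideal by blast
  have "(monom h :: ('n, 'k) mpoly) \<in> ideal_generated (monom ` H)"
    unfolding monom_mem_ideal using h mon_dvd_refl by blast
  then obtain g' where g': "g' \<in> G" "mon_dvd g' h" unfolding HM GM[symmetric] monom_mem_ideal by blast
  have "g' = g" by (rule minimal_generators_incomparable[OF G g'(1) g mon_dvd_trans[OF g'(2) h(2)]])
  then have "h = g" using g'(2) h(2) by (simp add: mon_dvd_antisym)
  then show "g \<in> H" using h(1) by simp
qed

lemma two_semidominant_nondominant: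
  assumes "two_semidominant M" "minimal_generating_set M G"
  shows "card {m \<in> G. \<not> dominant G m} = 2"
proof -
  obtain H where "minimal_generating_set M H" "card {m \<in> H. \<not> dominant H m} = 2"
    using assms(1) by (auto simp: two_semidominant_def)
  moreover from this(1) have "G = H"
    using minimal_generating_set_subset assms(2) by (intro subset_antisym) blast+
  ultimately show ?thesis by simp
qed


section \<open>Multidegrees when two generators are nondominant\<close>

text \<open>
  A dominant generator can be read off from a multidegree: it alone reaches a certain exponent of a
  certain variable, so the exponent in the lcm shows whether it takes part.
\<close>

lemma mdeg_eq_dominant_mem:
  assumes "finite G" "\<sigma> \<subseteq> G" "\<tau> \<subseteq> G" "mdeg \<sigma> = mdeg \<tau>" "dominant G m" "m \<in> \<sigma>"
  shows "m \<in> \<tau>"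
proof -
  have fin: "finite \<sigma>" "finite \<tau>" using assms(1-3) by (auto intro: finite_subset)
  obtain x k where k: "k \<ge> 1" "mon_dvd (var_power x k) m"
    "\<And>m'. m' \<in> G - {m} \<Longrightarrow> \<not> mon_dvd (var_power x k) m'"
    using assms(5) by (auto simp: dominant_def)
  have "k \<le> Poly_Mapping.lookup (mdeg \<sigma>) x"
    using k(2) assms(6) by (auto simp: le_lookup_mdeg_iff[OF fin(1) k(1)] var_power_dvd)
  then obtain l where "l \<in> \<tau>" "k \<le> Poly_Mapping.lookup l x"
    unfolding assms(4) le_lookup_mdeg_iff[OF fin(2) k(1)] by blast
  then show ?thesis using k(3)[of l] assms(3) by (auto simp: var_power_dvd)
qed

lemma mdeg_eq_parts:
  assumes "finite G" "\<sigma> \<subseteq> G" "\<tau> \<subseteq> G" "mdeg \<sigma> = mdeg \<tau>"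
  defines "N \<equiv> {m \<in> G. \<not> dominant G m}"
  shows "\<sigma> - N = \<tau> - N" "card \<sigma> = card (\<sigma> - N) + card (\<sigma> \<inter> N)" "card \<tau> = card (\<sigma> - N) + card (\<tau> \<inter> N)"
proof -
  have fin: "finite \<sigma>" "finite \<tau>" using assms(1-3) by (auto intro: finite_subset)
  show eq: "\<sigma> - N = \<tau> - N"
    using mdeg_eq_dominant_mem[OF assms(1-4)] mdeg_eq_dominant_mem[OF assms(1,3,2) assms(4)[symmetric]] assms(2,3)
    unfolding N_def by blast
  show "card \<sigma> = card (\<sigma> - N) + card (\<sigma> \<inter> N)" using card_Diff_subset_Int[of \<sigma> N] card_mono[of \<sigma> "\<sigma> \<inter> N"] fin by simp
  show "card \<tau> = card (\<sigma> - N) + card (\<tau> \<inter> N)" unfolding eq using card_Diff_subset_Int[of \<tau> N] card_mono[of \<tau> "\<tau> \<inter> N"] fin by simp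
qed

lemma subsets_of_pair:
  assumes "card N = 2" "X \<subseteq> N" "Y \<subseteq> N" "card X = Suc (card Y)"
  shows "Y \<subseteq> X" "Y = {} \<or> X = N"
proof -
  have "finite N" using assms(1) by (auto intro: card_ge_0_finite)
  then have fin: "finite X" "finite Y" using assms(2,3) finite_subset by auto
  have "card X \<le> 2" using card_mono[OF \<open>finite N\<close> assms(2)] assms(1) by simp
  then have "card Y = 0 \<or> card X = card N" using assms(1,4) by linarith
  then show *: "Y = {} \<or> X = N" using fin assms(2) \<open>finite N\<close> by (auto dest: card_subset_eq)
  show "Y \<subseteq> X" using * assms(3) by blast
qed

text \<open>
  Symbols of equal multidegree differ only by subsets of a set of two nondominant generators.
  Subsets of a pair whose sizes differ by one are nested; for a set of three generators this would
  fail.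
\<close>

lemma mdeg_eq_imp_facet:
  assumes G: "finite G" "card {m \<in> G. \<not> dominant G m} = 2"
    and \<sigma>\<tau>: "\<sigma> \<subseteq> G" "\<tau> \<subseteq> G" "mdeg \<sigma> = mdeg \<tau>" "card \<sigma> = Suc (card \<tau>)"
  shows "facet \<tau> \<sigma>"
proof -
  let ?N = "{m \<in> G. \<not> dominant G m}"
  note parts = mdeg_eq_parts[OF G(1) \<sigma>\<tau>(1-3)]
  have c: "card (\<sigma> \<inter> ?N) = Suc (card (\<tau> \<inter> ?N))" using parts(2,3) \<sigma>\<tau>(4) by simp
  have "\<tau> \<inter> ?N \<subseteq> \<sigma> \<inter> ?N" by (rule subsets_of_pair(1)[OF G(2) _ _ c]) auto
  then have sub: "\<tau> \<subseteq> \<sigma>" using parts(1) by blast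
  have "finite \<sigma>" "finite \<tau>" using G(1) \<sigma>\<tau>(1,2) by (auto intro: finite_subset)
  then have "card (\<sigma> - \<tau>) = 1" using sub \<sigma>\<tau>(4) by (simp add: card_Diff_subset)
  then obtain l where "\<sigma> - \<tau> = {l}" by (auto simp: card_1_singleton_iff)
  then show ?thesis using sub unfolding facet_def by blast
qed

text \<open>
  Of the subset sizes 0, 1, 2 of a pair, two consecutive ones always include 0 or 2, and a subset of
  such a size is unique.
\<close>

lemma mdeg_eq_pairs_meet:
  assumes G: "finite G" "card {m \<in> G. \<not> dominant G m} = 2"
    and sub: "\<sigma> \<subseteq> G" "\<tau> \<subseteq> G" "\<sigma>' \<subseteq> G" "\<tau>' \<subseteq> G"
    and mdeg: "mdeg \<sigma> = mdeg \<tau>" "mdeg \<sigma>' = mdeg \<tau>'" "mdeg \<sigma> = mdeg \<sigma>'"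
    and card: "card \<sigma> = Suc (card \<tau>)" "card \<sigma>' = Suc (card \<tau>')" "card \<sigma> = card \<sigma>'"
  shows "\<sigma> = \<sigma>' \<or> \<tau> = \<tau>'"
proof -
  obtain N where N: "N = {m \<in> G. \<not> dominant G m}" by simp
  note p1 = mdeg_eq_parts[OF G(1) sub(1,2) mdeg(1), folded N]
  note p2 = mdeg_eq_parts[OF G(1) sub(3,4) mdeg(2), folded N]
  note p3 = mdeg_eq_parts[OF G(1) sub(1,3) mdeg(3), folded N]
  have c1: "card (\<sigma> \<inter> N) = Suc (card (\<tau> \<inter> N))" using p1(2,3) card(1) by simp
  have c2: "card (\<sigma>' \<inter> N) = Suc (card (\<tau>' \<inter> N))" using p2(2,3) card(2) by simp
  have c3: "card (\<sigma> \<inter> N) = card (\<sigma>' \<inter> N)" using p3(2,3) card(3) by simp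
  have s1: "\<tau> \<inter> N = {} \<or> \<sigma> \<inter> N = N" by (rule subsets_of_pair(2)[OF G(2)[folded N] _ _ c1]) auto
  have s2: "\<tau>' \<inter> N = {} \<or> \<sigma>' \<inter> N = N" by (rule subsets_of_pair(2)[OF G(2)[folded N] _ _ c2]) auto
  have "\<tau> \<inter> N = {} \<and> \<tau>' \<inter> N = {} \<or> \<sigma> \<inter> N = N \<and> \<sigma>' \<inter> N = N"
  proof (cases "card (\<sigma> \<inter> N) = 2")
    case True
    then have "card (\<tau> \<inter> N) \<noteq> 0" "card (\<tau>' \<inter> N) \<noteq> 0" using c1 c2 c3 by simp_all
    then have "\<tau> \<inter> N \<noteq> {}" "\<tau>' \<inter> N \<noteq> {}" by auto
    then show ?thesis using s1 s2 by blast
  next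
    case False
    then have "\<sigma> \<inter> N \<noteq> N" "\<sigma>' \<inter> N \<noteq> N" using c3 G(2)[folded N] by auto
    then show ?thesis using s1 s2 by blast
  qed
  then have "\<sigma> \<inter> N = \<sigma>' \<inter> N \<or> \<tau> \<inter> N = \<tau>' \<inter> N" by auto
  moreover have "\<tau> - N = \<tau>' - N" "\<sigma> - N = \<sigma>' - N" using p1(1) p2(1) p3(1) by simp_all
  ultimately show ?thesis using Un_Diff_Int by metis
qed

section \<open>The Taylor resolution\<close>

lemma taylor_basis_expansion:
  fixes v :: "('n, 'k::field) chain"
  shows "v = (\<Sum>\<sigma>\<in>Poly_Mapping.keys v. smul (Poly_Mapping.lookup v \<sigma>) (taylor_basis \<sigma>))"
proof -
  have "smul p (taylor_basis \<sigma>) = Poly_Mapping.single \<sigma> p" for \<sigma> and p :: "('n, 'k) mpoly"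
    by (rule poly_mapping_eqI) (simp add: taylor_basis_def lookup_smul lookup_single when_def)
  then show ?thesis using poly_expansion[of v] by simp
qed

lemma span_taylor_basis:
  fixes Q :: "'n symbol set"
  shows "free_mod.span (taylor_basis ` Q :: ('n, 'k::field) chain set) = {v. Poly_Mapping.keys v \<subseteq> Q}"
    (is "?S = ?V")
proof (rule subset_antisym)
  show "?S \<subseteq> ?V"
  proof (rule free_mod.span_minimal)
    show "taylor_basis ` Q \<subseteq> ?V" by (auto simp: taylor_basis_def)
    show "free_mod.subspace ?V"
    proof (rule free_mod.subspaceI)
      show "v + w \<in> ?V"
        if "v \<in> ?V" "w \<in> ?V" for v w :: "('n, 'k) chain"
        using that keys_add[of v w] by blast
      show "smul c v \<in> ?V" if "v \<in> ?V"
        for c and v :: "('n, 'k) chain"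
        using that by (force simp: in_keys_iff lookup_smul)
    qed simp
  qed
  show "?V \<subseteq> ?S"
  proof
    fix v :: "('n, 'k) chain" assume v: "v \<in> ?V"
    have "v = (\<Sum>\<sigma>\<in>Poly_Mapping.keys v. smul (Poly_Mapping.lookup v \<sigma>) (taylor_basis \<sigma>))"
      by (rule taylor_basis_expansion)
    also have "\<dots> \<in> ?S"
      using v by (intro free_mod.span_sum free_mod.span_scale free_mod.span_base) auto
    finally show "v \<in> ?S" .
  qed
qed

lemma degree_part_taylor:
  "degree_part (taylor_based ls) j = {v. \<forall>\<sigma>\<in>Poly_Mapping.keys v. \<sigma> \<subseteq> set ls \<and> card \<sigma> = j}"
  by (auto simp: degree_part_def taylor_based_def span_taylor_basis)

lemma indep_family_taylor_basis:
  fixes Q :: "'n symbol set"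
  assumes "finite Q"
  shows "indep_family Q (taylor_basis :: 'n symbol \<Rightarrow> ('n, 'k::field) chain)"
  unfolding indep_family_def
proof (intro allI impI ballI)
  fix c :: "'n symbol \<Rightarrow> ('n, 'k) mpoly" and \<sigma>
  assume 0: "(\<Sum>\<sigma>\<in>Q. smul (c \<sigma>) (taylor_basis \<sigma>)) = 0" and \<sigma>: "\<sigma> \<in> Q"
  have "Poly_Mapping.lookup (\<Sum>\<sigma>\<in>Q. smul (c \<sigma>) (taylor_basis \<sigma>)) \<sigma> = (\<Sum>\<rho>\<in>Q. if \<rho> = \<sigma> then c \<rho> else 0)"
    by (simp add: lookup_sum lookup_smul taylor_basis_def lookup_single when_def if_distrib cong: if_cong)
  also have "\<dots> = c \<sigma>" using assms \<sigma> by simp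
  finally show "c \<sigma> = 0" using 0 by simp
qed

text \<open>
  The sign of a facet does not refer to indices here, so that inserting a generator in front of all
  others visibly flips the signs of the other facets.
\<close>

definition facet_sign :: "'n mon list \<Rightarrow> 'n mon \<Rightarrow> 'n symbol \<Rightarrow> 'k::field" where
  "facet_sign ls l \<sigma> = (- 1) ^ length (takeWhile (\<lambda>x. x \<noteq> l) (filter (\<lambda>x. x \<in> \<sigma>) ls))"

lemma taylor_boundary_sum:
  fixes ls :: "('n::finite) mon list"
  assumes "distinct ls" "\<sigma> \<subseteq> set ls"
  shows "(taylor_boundary ls \<sigma> :: ('n, 'k::field) chain) =
    (\<Sum>l\<in>\<sigma>. smul (Poly_Mapping.single (mdeg \<sigma> - mdeg (\<sigma> - {l})) (facet_sign ls l \<sigma>)) (taylor_basis (\<sigma> - {l})))"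
proof -
  define rs where "rs = filter (\<lambda>l. l \<in> \<sigma>) ls"
  have rs: "distinct rs" "set rs = \<sigma>" using assms by (auto simp: rs_def)
  have sign: "(- 1) ^ i * (monom m :: ('n, 'k) mpoly) = (Poly_Mapping.single m ((- 1) ^ i) :: ('n, 'k) mpoly)" for i and m :: "'n mon"
    by (induction i) (simp_all add: monom_def single_uminus[symmetric] mult.assoc)
  have "takeWhile (\<lambda>x. x \<noteq> rs ! i) rs = take i rs" if "i < length rs" for i
    using that rs(1) by (intro takeWhile_eq_take_P_nth) (auto simp: nth_eq_iff_index_eq)
  then have fs: "facet_sign ls (rs ! i) \<sigma> = (- 1 :: 'k) ^ i" if "i < length rs" for i
    using that by (simp add: facet_sign_def rs_def[symmetric])
  have "(taylor_boundary ls \<sigma> :: ('n, 'k) chain) = (\<Sum>i<length rs. smul (Poly_Mapping.single (mdeg \<sigma> - mdeg (\<sigma> - {rs ! i}))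
      (facet_sign ls (rs ! i) \<sigma>)) (taylor_basis (\<sigma> - {rs ! i})))"
    unfolding taylor_boundary_def Let_def rs_def[symmetric] by (intro sum.cong) (simp_all add: sign fs)
  also have "\<dots> = (\<Sum>l\<in>\<sigma>. smul (Poly_Mapping.single (mdeg \<sigma> - mdeg (\<sigma> - {l})) (facet_sign ls l \<sigma>)) (taylor_basis (\<sigma> - {l})))"
    by (rule sum.reindex_bij_betw[OF bij_betw_nth]) (use rs in auto)
  finally show ?thesis .
qed

lemma taylor_diff_hom: "module_hom smul smul (taylor_diff ls)"
proof (unfold_locales)
  show "taylor_diff ls (v + w) = taylor_diff ls v + taylor_diff ls w" for v w
    unfolding taylor_diff_def
    by (rule setsum_keys_plus_distrib) (simp_all add: free_mod.scale_left_distrib)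
  show "taylor_diff ls (smul r v) = smul r (taylor_diff ls v)" for r v
  proof -
    have "taylor_diff ls (smul r v)
        = (\<Sum>\<sigma>\<in>Poly_Mapping.keys v. smul (r * Poly_Mapping.lookup v \<sigma>) (taylor_boundary ls \<sigma>))"
      unfolding taylor_diff_def lookup_smul
      by (rule sum.mono_neutral_left) (auto simp: in_keys_iff lookup_smul)
    then show ?thesis by (simp add: taylor_diff_def free_mod.scale_sum_right)
  qed
qed

lemma taylor_diff_single: "taylor_diff ls (Poly_Mapping.single \<sigma> p) = smul p (taylor_boundary ls \<sigma>)"
  by (simp add: taylor_diff_def)

text \<open>
  If \<open>mdeg \<sigma>\<close> divides \<open>m\<close>, this is \<open>c\<close> times the monomial multiple of \<open>\<sigma>\<close> that has multidegree \<open>m\<close>.  In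
  these terms the differential has no monomial coefficients, only signs.
\<close>

definition chain_term :: "('n::finite) mon \<Rightarrow> 'n symbol \<Rightarrow> 'k \<Rightarrow> ('n, 'k::field) chain" where
  "chain_term m \<sigma> c = Poly_Mapping.single \<sigma> (Poly_Mapping.single (m - mdeg \<sigma>) c)"

lemma chain_term_add: "chain_term m \<sigma> (c + c') = chain_term m \<sigma> c + chain_term m \<sigma> c'"
  by (simp add: chain_term_def single_add)

lemma chain_term_0 [simp]: "chain_term m \<sigma> 0 = 0"
  by (simp add: chain_term_def)

lemma chain_term_minus: "chain_term m \<sigma> (- c) = - chain_term m \<sigma> c"
  by (simp add: chain_term_def single_uminus)

lemma chain_term_expansion:
  fixes v :: "('n::finite, 'k::field) chain"
  shows "v = (\<Sum>\<sigma>\<in>Poly_Mapping.keys v. \<Sum>t\<in>Poly_Mapping.keys (Poly_Mapping.lookup v \<sigma>).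
          chain_term (t + mdeg \<sigma>) \<sigma> (Poly_Mapping.lookup (Poly_Mapping.lookup v \<sigma>) t))"
proof -
  have single_sum: "Poly_Mapping.single \<sigma> (sum f A) = (\<Sum>t\<in>A. Poly_Mapping.single \<sigma> (f t))"
    for \<sigma> and f :: "_ \<Rightarrow> ('n, 'k) mpoly" and A :: "'n mon set"
    by (induction A rule: infinite_finite_induct) (simp_all add: single_add)
  have "v = (\<Sum>\<sigma>\<in>Poly_Mapping.keys v. Poly_Mapping.single \<sigma> (Poly_Mapping.lookup v \<sigma>))"
    by (rule poly_expansion)
  also have "\<dots> = (\<Sum>\<sigma>\<in>Poly_Mapping.keys v. \<Sum>t\<in>Poly_Mapping.keys (Poly_Mapping.lookup v \<sigma>).
      chain_term (t + mdeg \<sigma>) \<sigma> (Poly_Mapping.lookup (Poly_Mapping.lookup v \<sigma>) t))"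
    unfolding chain_term_def add_diff_cancel_right' single_sum[symmetric] poly_expansion[symmetric] ..
  finally show ?thesis .
qed

lemma taylor_diff_term:
  assumes "distinct ls" "\<sigma> \<subseteq> set ls" "mon_dvd (mdeg \<sigma>) m"
  shows "taylor_diff ls (chain_term m \<sigma> c) = (\<Sum>l\<in>\<sigma>. chain_term m (\<sigma> - {l}) (facet_sign ls l \<sigma> * c))"
  unfolding chain_term_def taylor_diff_single taylor_boundary_sum[OF assms(1,2)] free_mod.scale_sum_right
proof (rule sum.cong)
  fix l assume "l \<in> \<sigma>"
  have "finite \<sigma>" using assms(2) by (auto intro: finite_subset)
  then have *: "mon_dvd (mdeg (\<sigma> - {l})) (mdeg \<sigma>)" by (intro mdeg_mono) auto
  have "m - mdeg \<sigma> + (mdeg \<sigma> - mdeg (\<sigma> - {l})) = m - mdeg (\<sigma> - {l})"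
    using * assms(3) unfolding mon_dvd_iff
    by (intro poly_mapping_eqI) (simp add: lookup_add lookup_minus)
  then show "smul (Poly_Mapping.single (m - mdeg \<sigma>) c)
      (smul (Poly_Mapping.single (mdeg \<sigma> - mdeg (\<sigma> - {l})) (facet_sign ls l \<sigma>)) (taylor_basis (\<sigma> - {l})))
    = Poly_Mapping.single (\<sigma> - {l}) (Poly_Mapping.single (m - mdeg (\<sigma> - {l})) (facet_sign ls l \<sigma> * c))"
    by (intro poly_mapping_eqI)
       (simp add: lookup_smul taylor_basis_def lookup_single when_def mult_single mult.commute)
qed simp

lemma facet_sign_first:
  assumes "\<sigma> \<inter> set xs = {}" "l \<in> \<sigma>"
  shows "facet_sign (xs @ l # ys) l \<sigma> = 1"
proof -
  have "filter (\<lambda>x. x \<in> \<sigma>) xs = []" using assms(1) by (auto simp: filter_empty_conv)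
  then show ?thesis using assms(2) by (simp add: facet_sign_def)
qed

lemma facet_sign_insert_first:
  assumes "\<sigma> \<inter> set xs = {}" "l \<notin> \<sigma>" "r \<in> \<sigma>" "distinct (xs @ l # ys)"
  shows "facet_sign (xs @ l # ys) r (insert l \<sigma>) = - facet_sign (xs @ l # ys) r \<sigma>"
proof -
  have xs: "filter (\<lambda>x. x \<in> \<sigma>) xs = []" "filter (\<lambda>x. x \<in> insert l \<sigma>) xs = []"
    using assms(1,4) by (auto simp: filter_empty_conv)
  have ys: "filter (\<lambda>x. x \<in> insert l \<sigma>) ys = filter (\<lambda>x. x \<in> \<sigma>) ys"
    using assms(4) by (intro filter_cong) auto
  show ?thesis using assms(2,3) unfolding facet_sign_def filter_append xs filter.simps ys by auto
qed

text \<open>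
  The contracting homotopy.  In multidegree \<open>m\<close> the Taylor complex is, over the field, the chain
  complex of a simplex whose vertices are the generators dividing \<open>m\<close>, and it is contracted by
  inserting one vertex.  The function \<open>g\<close> chooses this vertex for each multidegree.
\<close>

definition insert_term :: "(('n::finite) mon \<Rightarrow> 'n mon) \<Rightarrow> 'n symbol \<Rightarrow> 'n mon \<Rightarrow> 'k \<Rightarrow> ('n, 'k::field) chain" where
  "insert_term g \<sigma> m c = (if g m \<in> \<sigma> then 0 else chain_term m (insert (g m) \<sigma>) c)"

definition homotopy :: "(('n::finite) mon \<Rightarrow> 'n mon) \<Rightarrow> ('n, 'k::field) chain \<Rightarrow> ('n, 'k) chain" where
  "homotopy g v = (\<Sum>\<sigma>\<in>Poly_Mapping.keys v. \<Sum>t\<in>Poly_Mapping.keys (Poly_Mapping.lookup v \<sigma>).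
      insert_term g \<sigma> (t + mdeg \<sigma>) (Poly_Mapping.lookup (Poly_Mapping.lookup v \<sigma>) t))"

lemma additive_homotopy: "Modules.additive (homotopy g)"
proof
  have *: "insert_term g \<sigma> m (c + c') = insert_term g \<sigma> m c + insert_term g \<sigma> m c'" for \<sigma> m c c'
    by (simp add: insert_term_def chain_term_add)
  have 0: "insert_term g \<sigma> m 0 = 0" for \<sigma> m
    by (simp add: insert_term_def)
  show "homotopy g (v + w) = homotopy g v + homotopy g w" for v w
    unfolding homotopy_def
    by (rule setsum_keys_plus_distrib, simp, rule setsum_keys_plus_distrib) (simp_all add: * 0)
qed

lemma homotopy_term:
  assumes "mon_dvd (mdeg \<sigma>) m"
  shows "homotopy g (chain_term m \<sigma> c) = insert_term g \<sigma> m c"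
proof (cases "c = 0")
  case False
  then have "Poly_Mapping.single (m - mdeg \<sigma>) c \<noteq> 0" by (metis lookup_single_eq lookup_zero)
  then show ?thesis using False by (simp add: homotopy_def chain_term_def[of m \<sigma>] mon_diff_add[OF assms])
qed (simp add: homotopy_def insert_term_def)

text \<open>
  Let \<open>h\<close> be the homotopy.  If the inserted vertex \<open>l\<close> precedes all vertices of \<open>\<sigma>\<close>, then in \<open>d h\<close>
  the removal of \<open>l\<close> gives back \<open>\<sigma>\<close> with sign \<open>1\<close>, and the other facets of \<open>\<sigma> \<union> {l}\<close> cancel against the
  terms of \<open>h d\<close>, because \<open>l\<close> shifts the positions of the vertices by one.  If \<open>l\<close> is already the first
  vertex of \<open>\<sigma>\<close>, then \<open>h\<close> vanishes on \<open>\<sigma>\<close> and on every facet except the one without \<open>l\<close>.  The identity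
  includes the empty symbol, where \<open>h d = 0\<close>.
\<close>

lemma homotopy_term_identity:
  fixes c :: "'k::field" and ls :: "('n::finite) mon list"
  assumes ls: "distinct ls" "ls = xs @ l # ys" and \<sigma>: "\<sigma> \<subseteq> set ls" "\<sigma> \<inter> set xs = {}"
    and m: "mon_dvd (mdeg \<sigma>) m" "mon_dvd l m" "g m = l"
  shows "taylor_diff ls (homotopy g (chain_term m \<sigma> c)) + homotopy g (taylor_diff ls (chain_term m \<sigma> c))
    = chain_term m \<sigma> c"
proof -
  interpret h: Modules.additive "homotopy g" by (rule additive_homotopy)
  have fin: "finite \<sigma>" using \<sigma>(1) by (auto intro: finite_subset)
  have dvd: "mon_dvd (mdeg (\<sigma> - {r})) m" for r
    using m(1) fin by (auto simp: mdeg_dvd_iff)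
  have hd: "homotopy g (taylor_diff ls (chain_term m \<sigma> c))
      = (\<Sum>r\<in>\<sigma>. insert_term g (\<sigma> - {r}) m (facet_sign ls r \<sigma> * c))"
    unfolding taylor_diff_term[OF ls(1) \<sigma>(1) m(1)] h.sum by (simp add: homotopy_term dvd)
  show ?thesis
  proof (cases "l \<in> \<sigma>")
    case True
    interpret d: module_hom smul smul "taylor_diff ls :: ('n, 'k) chain \<Rightarrow> _" by (rule taylor_diff_hom)
    have "(\<Sum>r\<in>\<sigma>. insert_term g (\<sigma> - {r}) m (facet_sign ls r \<sigma> * c))
        = (\<Sum>r\<in>{l}. insert_term g (\<sigma> - {r}) m (facet_sign ls r \<sigma> * c))"
      by (rule sum.mono_neutral_right) (use True fin m(3) in \<open>auto simp: insert_term_def\<close>)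
    also have "\<dots> = chain_term m \<sigma> c"
    proof -
      have "facet_sign ls l \<sigma> = (1 :: 'k)" unfolding ls(2) by (rule facet_sign_first[OF \<sigma>(2) True])
      then show ?thesis using True m(3) by (simp add: insert_term_def insert_absorb)
    qed
    finally have "homotopy g (taylor_diff ls (chain_term m \<sigma> c)) = chain_term m \<sigma> c" by (simp only: hd)
    moreover have "homotopy g (chain_term m \<sigma> c) = 0"
      using True m(3) by (simp add: homotopy_term[OF m(1)] insert_term_def)
    ultimately show ?thesis by simp
  next
    case False
    have sub: "insert l \<sigma> \<subseteq> set ls" using \<sigma>(1) ls(2) by auto
    have dvd': "mon_dvd (mdeg (insert l \<sigma>)) m" using m(1,2) fin by (simp add: mdeg_dvd_iff)
    have "taylor_diff ls (homotopy g (chain_term m \<sigma> c))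
        = (\<Sum>r\<in>insert l \<sigma>. chain_term m (insert l \<sigma> - {r}) (facet_sign ls r (insert l \<sigma>) * c))"
      using False m(3) by (simp add: homotopy_term[OF m(1)] insert_term_def taylor_diff_term[OF ls(1) sub dvd'])
    also have "\<dots> = chain_term m (insert l \<sigma> - {l}) (facet_sign ls l (insert l \<sigma>) * c)
        + (\<Sum>r\<in>\<sigma>. chain_term m (insert l \<sigma> - {r}) (facet_sign ls r (insert l \<sigma>) * c))"
      using fin False by simp
    also have "chain_term m (insert l \<sigma> - {l}) (facet_sign ls l (insert l \<sigma>) * c) = chain_term m \<sigma> c"
    proof -
      have "facet_sign ls l (insert l \<sigma>) = (1 :: 'k)"
        unfolding ls(2) by (rule facet_sign_first) (use \<sigma>(2) ls in auto)
      then show ?thesis using False by simp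
    qed
    also have "(\<Sum>r\<in>\<sigma>. chain_term m (insert l \<sigma> - {r}) (facet_sign ls r (insert l \<sigma>) * c))
        = - (\<Sum>r\<in>\<sigma>. insert_term g (\<sigma> - {r}) m (facet_sign ls r \<sigma> * c))"
      unfolding sum_negf[symmetric]
    proof (rule sum.cong)
      fix r assume r: "r \<in> \<sigma>"
      then have "insert l \<sigma> - {r} = insert l (\<sigma> - {r})" using False by auto
      moreover have "facet_sign ls r (insert l \<sigma>) = - (facet_sign ls r \<sigma> :: 'k)"
        using facet_sign_insert_first[OF \<sigma>(2) False r, of ys] ls by simp
      ultimately show "chain_term m (insert l \<sigma> - {r}) (facet_sign ls r (insert l \<sigma>) * c)
          = - insert_term g (\<sigma> - {r}) m (facet_sign ls r \<sigma> * c)"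
        using False m(3) by (simp add: insert_term_def chain_term_minus)
    qed simp
    finally show ?thesis by (simp add: hd)
  qed
qed

text \<open>
  For \<open>d \<circ> d = 0\<close> the homotopy inserts the first element of the symbol \<open>\<sigma>\<close> itself.  Then \<open>\<sigma>\<close> is the
  image of a smaller symbol under the homotopy \<open>h\<close>, and \<open>d h = 1 - h d\<close>, used twice, reduces the
  claim to that symbol.
\<close>

lemma taylor_diff_diff_term:
  fixes c :: "'k::field" and ls :: "('n::finite) mon list"
  assumes "distinct ls" "\<sigma> \<subseteq> set ls" "mon_dvd (mdeg \<sigma>) m"
  shows "taylor_diff ls (taylor_diff ls (chain_term m \<sigma> c)) = 0"
  using assms(2,3)
proof (induction "card \<sigma>" arbitrary: \<sigma> c)
  case 0
  then have "\<sigma> = {}" using assms(2) by (metis List.finite_set card_0_eq finite_subset)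
  then show ?case using taylor_diff_term[OF assms(1), of "{}" m c] by (simp add: taylor_diff_def mon_dvd_iff)
next
  case (Suc n)
  interpret d: module_hom smul smul "taylor_diff ls :: ('n, 'k) chain \<Rightarrow> _" by (rule taylor_diff_hom)
  have fin: "finite \<sigma>" using Suc.prems(1) by (auto intro: finite_subset)
  have "\<exists>x\<in>set ls. x \<in> \<sigma>" using Suc(2) Suc.prems(1) by (metis card.empty ex_in_conv nat.distinct(1) subset_iff)
  then obtain xs l ys where l: "ls = xs @ l # ys" "l \<in> \<sigma>" "\<forall>x\<in>set xs. x \<notin> \<sigma>"
    using split_list_first_prop[of ls "\<lambda>x. x \<in> \<sigma>"] by blast
  define h :: "('n, 'k) chain \<Rightarrow> ('n, 'k) chain" where "h = homotopy (\<lambda>_. l)"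
  interpret h: Modules.additive h unfolding h_def by (rule additive_homotopy)
  have dvd_l: "mon_dvd l m" using Suc.prems(2) l(2) fin by (simp add: mdeg_dvd_iff)
  have dvd: "mon_dvd (mdeg \<rho>) m" if "\<rho> \<subseteq> \<sigma>" for \<rho>
    using that Suc.prems(2) fin finite_subset[OF that fin] by (auto simp: mdeg_dvd_iff)
  have dh: "taylor_diff ls (h (chain_term m \<rho> e)) = chain_term m \<rho> e - h (taylor_diff ls (chain_term m \<rho> e))"
    if "\<rho> \<subseteq> \<sigma>" for \<rho> e
    using homotopy_term_identity[OF assms(1) l(1) _ _ dvd[OF that] dvd_l, of "\<lambda>_. l" e] that Suc.prems(1) l(3)
    by (auto simp: h_def eq_diff_eq)
  let ?\<rho> = "\<sigma> - {l}"
  let ?w = "chain_term m ?\<rho> c"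
  have w: "h ?w = chain_term m \<sigma> c"
    unfolding h_def homotopy_term[OF dvd[of ?\<rho>, OF Diff_subset]] insert_term_def using l(2) by (simp add: insert_absorb)
  have dw: "taylor_diff ls ?w = (\<Sum>r\<in>?\<rho>. chain_term m (?\<rho> - {r}) (facet_sign ls r ?\<rho> * c))"
    by (rule taylor_diff_term[OF assms(1) _ dvd]) (use Suc.prems(1) in auto)
  have ddw: "taylor_diff ls (taylor_diff ls ?w) = 0"
    by (rule Suc.hyps(1)) (use Suc(2) Suc.prems(1) l(2) fin dvd in auto)
  have "taylor_diff ls (h (taylor_diff ls ?w))
      = (\<Sum>r\<in>?\<rho>. taylor_diff ls (h (chain_term m (?\<rho> - {r}) (facet_sign ls r ?\<rho> * c))))"
    by (simp only: dw h.sum d.sum)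
  also have "\<dots> = (\<Sum>r\<in>?\<rho>. chain_term m (?\<rho> - {r}) (facet_sign ls r ?\<rho> * c)
      - h (taylor_diff ls (chain_term m (?\<rho> - {r}) (facet_sign ls r ?\<rho> * c))))"
    by (intro sum.cong refl dh) auto
  also have "\<dots> = taylor_diff ls ?w - h (taylor_diff ls (taylor_diff ls ?w))"
    by (simp only: dw h.sum d.sum sum_subtractf)
  also have "\<dots> = taylor_diff ls ?w" by (simp add: ddw h.zero)
  finally have "taylor_diff ls (h (taylor_diff ls ?w)) = taylor_diff ls ?w" .
  then show ?case
    using dh[of ?\<rho> c] by (simp add: w d.diff)
qed

lemma taylor_diff_diff:
  fixes v :: "('n::finite, 'k::field) chain"
  assumes "distinct ls" "\<And>\<sigma>. \<sigma> \<in> Poly_Mapping.keys v \<Longrightarrow> \<sigma> \<subseteq> set ls"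
  shows "taylor_diff ls (taylor_diff ls v) = 0"
proof -
  interpret d: module_hom smul smul "taylor_diff ls :: ('n, 'k) chain \<Rightarrow> _" by (rule taylor_diff_hom)
  show ?thesis
    by (subst chain_term_expansion[of v], unfold d.sum, intro sum.neutral ballI taylor_diff_diff_term)
       (use assms in \<open>auto simp: mon_dvd_add mon_dvd_refl\<close>)
qed

text \<open>
  For exactness the homotopy inserts the first generator that divides the multidegree.  It needs
  such a generator, and one exists except in the component of the empty symbol at the multidegrees
  outside the monomial ideal.
\<close>

lemma taylor_homotopy_identity:
  fixes v :: "('n::finite, 'k::field) chain"
  assumes "distinct ls" "\<And>\<sigma>. \<sigma> \<in> Poly_Mapping.keys v \<Longrightarrow> \<sigma> \<subseteq> set ls"
    and ex: "\<And>\<sigma> t. t \<in> Poly_Mapping.keys (Poly_Mapping.lookup v \<sigma>) \<Longrightarrow> \<exists>l\<in>set ls. mon_dvd l (t + mdeg \<sigma>)"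
  defines "h \<equiv> homotopy (\<lambda>m. hd (filter (\<lambda>l. mon_dvd l m) ls))"
  shows "taylor_diff ls (h v) + h (taylor_diff ls v) = v"
proof -
  interpret d: module_hom smul smul "taylor_diff ls :: ('n, 'k) chain \<Rightarrow> _" by (rule taylor_diff_hom)
  interpret h: Modules.additive h unfolding h_def by (rule additive_homotopy)
  let ?e = "\<lambda>\<sigma> t. chain_term (t + mdeg \<sigma>) \<sigma> (Poly_Mapping.lookup (Poly_Mapping.lookup v \<sigma>) t)"
  have e: "taylor_diff ls (h (?e \<sigma> t)) + h (taylor_diff ls (?e \<sigma> t)) = ?e \<sigma> t"
    if \<sigma>: "\<sigma> \<in> Poly_Mapping.keys v" and t: "t \<in> Poly_Mapping.keys (Poly_Mapping.lookup v \<sigma>)" for \<sigma> t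
  proof -
    let ?m = "t + mdeg \<sigma>"
    obtain xs l ys where l: "ls = xs @ l # ys" "mon_dvd l ?m" "\<forall>x\<in>set xs. \<not> mon_dvd x ?m"
      using split_list_first_prop[of ls "\<lambda>l. mon_dvd l ?m"] ex[OF t] by blast
    have "filter (\<lambda>l. mon_dvd l ?m) xs = []" using l(3) by (auto simp: filter_empty_conv)
    then have g: "hd (filter (\<lambda>l. mon_dvd l ?m) ls) = l" using l by simp
    have sub: "\<sigma> \<subseteq> set ls" by (rule assms(2)[OF \<sigma>])
    have dvd: "mon_dvd (mdeg \<sigma>) ?m" by (simp add: mon_dvd_add mon_dvd_refl)
    have "finite \<sigma>" using sub by (auto intro: finite_subset)
    then have "\<forall>x\<in>\<sigma>. mon_dvd x ?m" using dvd by (simp add: mdeg_dvd_iff)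
    then have "\<sigma> \<inter> set xs = {}" using l(3) by blast
    then show ?thesis unfolding h_def
      by (intro homotopy_term_identity[where g = "\<lambda>m. hd (filter (\<lambda>l. mon_dvd l m) ls)",
            OF assms(1) l(1) sub _ dvd l(2) g])
  qed
  have "taylor_diff ls (h v) + h (taylor_diff ls v)
      = (\<Sum>\<sigma>\<in>Poly_Mapping.keys v. \<Sum>t\<in>Poly_Mapping.keys (Poly_Mapping.lookup v \<sigma>).
          taylor_diff ls (h (?e \<sigma> t)) + h (taylor_diff ls (?e \<sigma> t)))"
    by (subst (1 2) chain_term_expansion[of v]) (simp only: d.sum h.sum sum.distrib)
  also have "\<dots> = v" unfolding chain_term_expansion[of v, symmetric]
    by (subst (5) chain_term_expansion[of v]) (intro sum.cong refl e)
  finally show ?thesis .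
qed

lemma homogeneous_taylor_basis: "homogeneous (mdeg \<sigma>) (taylor_basis \<sigma>)"
  by (auto simp: homogeneous_def taylor_basis_def lookup_single when_def)

lemma taylor_diff_basis: "taylor_diff ls (taylor_basis \<sigma>) = taylor_boundary ls \<sigma>"
  unfolding taylor_basis_def taylor_diff_single by simp

lemma homogeneous_taylor_boundary:
  assumes "distinct ls" "\<sigma> \<subseteq> set ls"
  shows "homogeneous (mdeg \<sigma>) (taylor_boundary ls \<sigma>)"
  unfolding taylor_boundary_sum[OF assms]
proof (intro homogeneous_sum homogeneous_smul[OF homogeneous_taylor_basis])
  fix l t
  assume "t \<in> Poly_Mapping.keys (Poly_Mapping.single (mdeg \<sigma> - mdeg (\<sigma> - {l})) (facet_sign ls l \<sigma>))"
  then have "t = mdeg \<sigma> - mdeg (\<sigma> - {l})" by (auto split: if_splits)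
  moreover have "finite \<sigma>" using assms(2) by (auto intro: finite_subset)
  ultimately show "t + mdeg (\<sigma> - {l}) = mdeg \<sigma>"
    using mon_diff_add[OF mdeg_mono[of \<sigma> "\<sigma> - {l}"]] by auto
qed

lemma degree_part_sum: "(\<And>i. i \<in> I \<Longrightarrow> f i \<in> degree_part F j) \<Longrightarrow> sum f I \<in> degree_part F j"
  unfolding degree_part_def by (rule free_mod.span_sum)

lemma taylor_boundary_support:
  fixes ls :: "('n::finite) mon list"
  assumes "distinct ls" "\<sigma> \<subseteq> set ls" "\<tau> \<in> Poly_Mapping.keys (taylor_boundary ls \<sigma> :: ('n, 'k::field) chain)"
  shows "\<tau> \<subseteq> set ls" "card \<sigma> = Suc (card \<tau>)"
proof -
  have "\<exists>l\<in>\<sigma>. \<tau> = \<sigma> - {l}"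
  proof (rule ccontr)
    assume "\<not> ?thesis"
    then have "Poly_Mapping.lookup (taylor_boundary ls \<sigma> :: ('n, 'k) chain) \<tau> = 0"
      unfolding taylor_boundary_sum[OF assms(1,2)] lookup_sum lookup_smul taylor_basis_def
      by (intro sum.neutral) (auto simp: lookup_single when_def)
    then show False using assms(3) by (simp add: in_keys_iff)
  qed
  moreover have "finite \<sigma>" using assms(2) by (auto intro: finite_subset)
  ultimately show "\<tau> \<subseteq> set ls" "card \<sigma> = Suc (card \<tau>)"
    using assms(2) card_Suc_Diff1[of \<sigma>] by auto
qed

lemma taylor_boundary_degree:
  assumes "distinct ls" "\<sigma> \<subseteq> set ls" "card \<sigma> = Suc j"
  shows "taylor_boundary ls \<sigma> \<in> degree_part (taylor_based ls) j"
  unfolding degree_part_taylor using taylor_boundary_support[OF assms(1,2)] assms(3) by auto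

lemma taylor_diff_degree:
  assumes "distinct ls" "v \<in> degree_part (taylor_based ls) (Suc j)"
  shows "taylor_diff ls v \<in> degree_part (taylor_based ls) j"
proof -
  have "taylor_boundary ls \<sigma> \<in> degree_part (taylor_based ls) j" if "\<sigma> \<in> Poly_Mapping.keys v" for \<sigma>
    using assms(2) that by (intro taylor_boundary_degree[OF assms(1)]) (auto simp: degree_part_taylor)
  then show ?thesis unfolding taylor_diff_def degree_part_def
    by (intro free_mod.span_sum free_mod.span_scale)
qed

lemma taylor_exact:
  fixes v :: "('n::finite, 'k::field) chain"
  assumes ls: "distinct ls" and v: "v \<in> degree_part (taylor_based ls) j" and d: "taylor_diff ls v = 0"
    and ex: "\<And>\<sigma> t. t \<in> Poly_Mapping.keys (Poly_Mapping.lookup v \<sigma>) \<Longrightarrow> \<exists>l\<in>set ls. mon_dvd l (t + mdeg \<sigma>)"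
  shows "v \<in> taylor_diff ls ` degree_part (taylor_based ls) (Suc j)"
proof -
  define g where "g = (\<lambda>m. hd (filter (\<lambda>l. mon_dvd l m) ls))"
  interpret h: Modules.additive "homotopy g :: ('n, 'k) chain \<Rightarrow> _" by (rule additive_homotopy)
  have v': "\<sigma> \<subseteq> set ls" "card \<sigma> = j" if "\<sigma> \<in> Poly_Mapping.keys v" for \<sigma>
    using v that by (simp_all add: degree_part_taylor)
  have "taylor_diff ls (homotopy g v) = v"
    using taylor_homotopy_identity[of ls v, OF ls v'(1) ex] unfolding g_def[symmetric] d h.zero by simp
  moreover have "homotopy g v \<in> degree_part (taylor_based ls) (Suc j)"
    unfolding homotopy_def
  proof (intro degree_part_sum)
    fix \<sigma> t assume \<sigma>: "\<sigma> \<in> Poly_Mapping.keys v" and t: "t \<in> Poly_Mapping.keys (Poly_Mapping.lookup v \<sigma>)"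
    let ?l = "g (t + mdeg \<sigma>)"
    have "filter (\<lambda>l. mon_dvd l (t + mdeg \<sigma>)) ls \<noteq> []"
      using ex[OF t] by (auto simp: filter_empty_conv)
    then have "?l \<in> set ls" unfolding g_def using hd_in_set by fastforce
    moreover have "finite \<sigma>" using v'(1)[OF \<sigma>] by (auto intro: finite_subset)
    ultimately show "insert_term g \<sigma> (t + mdeg \<sigma>) (Poly_Mapping.lookup (Poly_Mapping.lookup v \<sigma>) t)
        \<in> degree_part (taylor_based ls) (Suc j)"
      using v'[OF \<sigma>] by (auto simp: insert_term_def chain_term_def degree_part_taylor split: if_splits)
  qed
  ultimately show ?thesis by (metis image_eqI)
qed

lemma taylor_exact_positive:
  fixes ls :: "('n::finite) mon list"
  assumes ls: "distinct ls"
  shows "taylor_diff ls ` degree_part (taylor_based ls) (Suc (Suc j))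
    = {v \<in> degree_part (taylor_based ls) (Suc j). taylor_diff ls v = (0 :: ('n, 'k::field) chain)}"
proof (intro subset_antisym subsetI)
  fix v :: "('n, 'k) chain" assume "v \<in> taylor_diff ls ` degree_part (taylor_based ls) (Suc (Suc j))"
  then obtain w where w: "w \<in> degree_part (taylor_based ls) (Suc (Suc j))" "v = taylor_diff ls w" by auto
  have "\<sigma> \<subseteq> set ls" if "\<sigma> \<in> Poly_Mapping.keys w" for \<sigma>
    using w(1) that by (simp add: degree_part_taylor)
  then have "taylor_diff ls v = 0" unfolding w(2) by (rule taylor_diff_diff[OF ls])
  then show "v \<in> {v \<in> degree_part (taylor_based ls) (Suc j). taylor_diff ls v = 0}"
    using taylor_diff_degree[OF ls w(1)] w(2) by simp
next
  fix v :: "('n, 'k) chain" assume v: "v \<in> {v \<in> degree_part (taylor_based ls) (Suc j). taylor_diff ls v = 0}"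
  show "v \<in> taylor_diff ls ` degree_part (taylor_based ls) (Suc (Suc j))"
  proof (rule taylor_exact[OF ls])
    fix \<sigma> t assume "t \<in> Poly_Mapping.keys (Poly_Mapping.lookup v \<sigma>)"
    then have "\<sigma> \<in> Poly_Mapping.keys v" by (auto simp: in_keys_iff)
    then have \<sigma>: "\<sigma> \<subseteq> set ls" "card \<sigma> = Suc j" using v by (auto simp: degree_part_taylor)
    then obtain l where "l \<in> \<sigma>" by fastforce
    moreover have "finite \<sigma>" using \<sigma>(1) by (auto intro: finite_subset)
    ultimately have "mon_dvd l (mdeg \<sigma>)" using mdeg_dvd_iff[of \<sigma> "mdeg \<sigma>"] mon_dvd_refl by blast
    then show "\<exists>l\<in>set ls. mon_dvd l (t + mdeg \<sigma>)" using \<open>l \<in> \<sigma>\<close> \<sigma>(1) mon_dvd_add by blast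
  qed (use v in auto)
qed

text \<open>
  The augmentation reads off the coefficient of the empty symbol.  A polynomial lies in the ideal if
  and only if each of its monomials is divisible by a generator, and this is what the homotopy needs
  in degree 0.
\<close>

lemma taylor_resolution:
  fixes ls :: "('n::finite) mon list"
  assumes ls: "distinct ls" and M: "ideal_generated (monom ` set ls) = (M :: ('n, 'k::field) mpoly set)"
  shows "multigraded_free_resolution (taylor_diff ls) M (taylor_based ls)"
  unfolding multigraded_free_resolution_def
proof (intro conjI ballI allI)
  have fin: "finite (Pow (set ls))" by simp
  note ind = indep_family_taylor_basis[OF fin]
  show "free_on (taylor_based ls :: ('n, 'k) based)"
    using indep_family_inj_on[OF ind fin] indep_family_independent[OF ind fin]
    by (simp add: free_on_def taylor_based_def)
  show "module_hom smul smul (taylor_diff ls :: ('n, 'k) chain \<Rightarrow> _)" by (rule taylor_diff_hom)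
  fix \<sigma> assume \<sigma>: "\<sigma> \<in> fst (taylor_based ls :: ('n, 'k) based)"
  show "homogeneous (mdeg \<sigma>) (snd (taylor_based ls :: ('n, 'k) based) \<sigma>)"
    by (simp add: taylor_based_def homogeneous_taylor_basis)
  show "homogeneous (mdeg \<sigma>) (taylor_diff ls (snd (taylor_based ls :: ('n, 'k) based) \<sigma>))"
    using \<sigma> by (simp add: taylor_based_def taylor_diff_basis homogeneous_taylor_boundary[OF ls])
next
  show "taylor_diff ls ` degree_part (taylor_based ls) (Suc (Suc j))
    = {v \<in> degree_part (taylor_based ls) (Suc j). taylor_diff ls v = (0 :: ('n, 'k) chain)}" for j
    by (rule taylor_exact_positive[OF ls])
next
  let ?eps = "\<lambda>v :: ('n, 'k) chain. Poly_Mapping.lookup v {}"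
  have deg0: "v \<in> degree_part (taylor_based ls) 0 \<longleftrightarrow> Poly_Mapping.keys v \<subseteq> {{}}" for v :: "('n, 'k) chain"
    unfolding degree_part_taylor by (auto simp: subset_iff) (metis List.finite_set card_0_eq finite_subset subset_iff equals0D)+
  show "\<exists>\<epsilon>. module_hom smul (*) \<epsilon> \<and>
        (\<forall>m v. v \<in> degree_part (taylor_based ls :: ('n, 'k) based) 0 \<and> homogeneous m v \<longrightarrow> Poly_Mapping.keys (\<epsilon> v) \<subseteq> {m}) \<and>
        (\<forall>s. \<exists>v\<in>degree_part (taylor_based ls) 0. s - \<epsilon> v \<in> M) \<and>
        taylor_diff ls ` degree_part (taylor_based ls) (Suc 0) = {v \<in> degree_part (taylor_based ls) 0. \<epsilon> v \<in> M}"
  proof (intro exI[of _ ?eps] conjI allI impI)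
    interpret R: module "(*) :: ('n, 'k) mpoly \<Rightarrow> _ \<Rightarrow> _" by (rule module_ring)
    have M_span: "M = R.span (monom ` set ls)" using M by (simp add: ideal_generated_def)
    show "module_hom smul (*) ?eps"
      by unfold_locales (simp_all add: lookup_add lookup_smul)
    show "Poly_Mapping.keys (?eps v) \<subseteq> {m}" if "v \<in> degree_part (taylor_based ls) 0 \<and> homogeneous m v" for m v
      using that unfolding homogeneous_def by (metis add.right_neutral mdeg_empty singletonI subsetI)
    show "\<exists>v\<in>degree_part (taylor_based ls) 0. s - ?eps v \<in> M" for s
      by (rule bexI[of _ "Poly_Mapping.single {} s"]) (simp_all add: deg0 M_span R.span_zero)
    show "taylor_diff ls ` degree_part (taylor_based ls) (Suc 0) = {v \<in> degree_part (taylor_based ls) 0. ?eps v \<in> M}"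
    proof (intro subset_antisym subsetI)
      fix v :: "('n, 'k) chain" assume "v \<in> taylor_diff ls ` degree_part (taylor_based ls) (Suc 0)"
      then obtain w where w: "w \<in> degree_part (taylor_based ls) (Suc 0)" "v = taylor_diff ls w" by auto
      have "?eps v = (\<Sum>\<sigma>\<in>Poly_Mapping.keys w. Poly_Mapping.lookup w \<sigma> * ?eps (taylor_boundary ls \<sigma>))"
        by (simp add: w(2) taylor_diff_def lookup_sum lookup_smul)
      also have "\<dots> \<in> M"
        unfolding M_span
      proof (intro R.span_sum R.span_scale)
        fix \<sigma> assume "\<sigma> \<in> Poly_Mapping.keys w"
        then have \<sigma>: "\<sigma> \<subseteq> set ls" "card \<sigma> = 1" using w(1) by (auto simp: degree_part_taylor)
        then obtain l where l: "\<sigma> = {l}" by (auto simp: card_1_singleton_iff)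
        have "mon_dvd l (mdeg {l})" using mdeg_dvd_iff[of "{l}" "mdeg {l}"] mon_dvd_refl by blast
        moreover have "t = mdeg {l}" if "t \<in> Poly_Mapping.keys (?eps (taylor_boundary ls \<sigma>))" for t
          using homogeneous_taylor_boundary[OF ls \<sigma>(1), where 'b = 'k] that unfolding homogeneous_def l
          by (metis add.right_neutral mdeg_empty)
        ultimately have "?eps (taylor_boundary ls \<sigma>) \<in> ideal_generated (monom ` set ls)"
          unfolding ideal_generated_monoms using l \<sigma>(1) by blast
        then show "?eps (taylor_boundary ls \<sigma>) \<in> R.span (monom ` set ls)"
          by (simp add: ideal_generated_def)
      qed
      finally show "v \<in> {v \<in> degree_part (taylor_based ls) 0. ?eps v \<in> M}"
        using taylor_diff_degree[OF ls w(1)] w(2) by simp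
    next
      fix v assume v: "v \<in> {v \<in> degree_part (taylor_based ls) 0. ?eps v \<in> M}"
      then have keys: "Poly_Mapping.keys v \<subseteq> {{}}" by (simp add: deg0)
      show "v \<in> taylor_diff ls ` degree_part (taylor_based ls) (Suc 0)"
      proof (rule taylor_exact[OF ls])
        have 0: "taylor_boundary ls {} = (0 :: ('n, 'k) chain)"
          by (simp add: taylor_boundary_sum[OF ls])
        have "\<sigma> = {}" if "\<sigma> \<in> Poly_Mapping.keys v" for \<sigma> using keys that by blast
        then show "taylor_diff ls v = 0" unfolding taylor_diff_def by (intro sum.neutral ballI) (metis 0 free_mod.scale_zero_right)
        fix \<sigma> t assume t: "t \<in> Poly_Mapping.keys (Poly_Mapping.lookup v \<sigma>)"
        then have "\<sigma> \<in> Poly_Mapping.keys v" by (auto simp: in_keys_iff)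
        then have "\<sigma> = {}" using keys by auto
        then show "\<exists>l\<in>set ls. mon_dvd l (t + mdeg \<sigma>)"
          using v t by (simp add: M[symmetric] ideal_generated_monoms)
      qed (use v in simp)
    qed
  qed
qed

lemma taylor_split_stage:
  assumes ls: "distinct ls"
  shows "split_stage (taylor_diff ls) (Pow (set ls)) {} (taylor_based ls :: ('n::finite, 'k::field) based)
    (\<lambda>\<pi> \<rho>. if \<rho> \<subseteq> set ls then Poly_Mapping.lookup (taylor_boundary ls \<rho>) \<pi> else 0)"
proof (rule split_stage.intro, goal_cases)
  case 1
  show ?case by (rule taylor_diff_hom)
next
  case 2
  show ?case by simp
next
  case 3
  show ?case by (simp add: taylor_based_def)
next
  case 4
  show ?case by simp
next
  case 5
  show ?case by (simp add: taylor_based_def indep_family_taylor_basis)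
next
  case 6
  show ?case by (simp add: taylor_based_def)
next
  case 7
  show ?case by (simp add: taylor_based_def homogeneous_taylor_basis)
next
  case (8 \<rho>)
  then show ?case
    by (intro taylor_diff_diff[OF ls]) (auto simp: taylor_based_def taylor_basis_def)
next
  case (9 \<rho>)
  then have \<rho>: "\<rho> \<subseteq> set ls" by (simp add: taylor_based_def)
  let ?v = "taylor_boundary ls \<rho> :: ('n, 'k) chain"
  have "?v = (\<Sum>\<pi>\<in>Poly_Mapping.keys ?v. smul (Poly_Mapping.lookup ?v \<pi>) (taylor_basis \<pi>))"
    by (rule taylor_basis_expansion)
  also have "\<dots> = (\<Sum>\<pi>\<in>Pow (set ls). smul (Poly_Mapping.lookup ?v \<pi>) (taylor_basis \<pi>))"
  proof (rule sum.mono_neutral_left)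
    show "Poly_Mapping.keys ?v \<subseteq> Pow (set ls)"
      using taylor_boundary_support[OF ls \<rho>] by auto
  qed (auto simp: in_keys_iff)
  finally show ?case using \<rho> by (simp add: taylor_based_def taylor_diff_basis)
next
  case (10 \<pi> \<rho>)
  then show ?case
    using taylor_boundary_support[OF ls, of \<rho> \<pi>] by (auto simp: in_keys_iff split: if_splits)
next
  case (11 \<pi> \<rho> t)
  then show ?case
    using homogeneous_taylor_boundary[OF ls, of \<rho>] by (auto simp: homogeneous_def split: if_splits)
qed simp_all

lemma taylor_boundary_entry:
  assumes "distinct ls" "\<sigma> \<subseteq> set ls" "facet \<tau> \<sigma>" "mdeg \<sigma> = mdeg \<tau>"
  shows "\<exists>c :: 'k::field. c \<noteq> 0 \<and>
    Poly_Mapping.lookup (taylor_boundary ls \<sigma>) \<tau> = Poly_Mapping.single (0 :: ('n::finite) mon) c"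
proof -
  have fin: "finite \<sigma>" using assms(2) by (auto intro: finite_subset)
  obtain l where l: "l \<in> \<sigma>" "\<tau> = \<sigma> - {l}" using assms(3) by (auto simp: facet_def)
  have "Poly_Mapping.lookup (taylor_boundary ls \<sigma> :: ('n, 'k) chain) \<tau>
      = (\<Sum>r\<in>\<sigma>. if r = l then Poly_Mapping.single 0 (facet_sign ls r \<sigma>) else 0)"
    unfolding taylor_boundary_sum[OF assms(1,2)] lookup_sum lookup_smul taylor_basis_def
  proof (rule sum.cong)
    fix r assume r: "r \<in> \<sigma>"
    have "\<sigma> - {r} = \<sigma> - {l} \<longleftrightarrow> r = l" using r l(1) by auto
    then show "Poly_Mapping.single (mdeg \<sigma> - mdeg (\<sigma> - {r})) (facet_sign ls r \<sigma>)
          * Poly_Mapping.lookup (Poly_Mapping.single (\<sigma> - {r}) 1) \<tau>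
        = (if r = l then Poly_Mapping.single 0 (facet_sign ls r \<sigma> :: 'k) else 0)"
      using assms(4) by (auto simp: l(2) lookup_single when_def)
  qed simp
  also have "\<dots> = Poly_Mapping.single 0 (facet_sign ls l \<sigma>)" using fin l(1) by simp
  finally show ?thesis by (intro exI[of _ "facet_sign ls l \<sigma>"]) (simp add: facet_sign_def)
qed

section \<open>What remains after the cancellations\<close>

lemma mem_irrelevant_ideal:
  fixes p :: "('n, 'k::field) mpoly"
  assumes "\<And>t. t \<in> Poly_Mapping.keys p \<Longrightarrow> t \<noteq> 0"
  shows "p \<in> irrelevant_ideal"
proof -
  have "\<exists>x. mon_dvd (var_power x 1) t" if t: "t \<in> Poly_Mapping.keys p" for t
  proof -
    obtain x where "Poly_Mapping.lookup t x \<noteq> 0" using assms[OF t] by (metis lookup_zero poly_mapping_eqI)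
    then show ?thesis by (intro exI[of _ x]) (simp add: var_power_dvd)
  qed
  then have "p \<in> ideal_generated (monom ` range (\<lambda>x. var_power x 1))"
    by (simp add: ideal_generated_monoms)
  then show ?thesis by (simp add: irrelevant_ideal_def image_image)
qed

context split_stage
begin

lemma cancelled_label:
  assumes "(\<sigma>, \<tau>) \<in> R"
  shows "\<sigma> \<in> P" "\<tau> \<in> P" "\<sigma> \<notin> fst F" "\<tau> \<notin> fst F"
proof -
  have "\<sigma> \<in> fst ` R" "\<tau> \<in> snd ` R" using assms by (metis fst_conv image_eqI, metis snd_conv image_eqI)
  then show "\<sigma> \<in> P" "\<tau> \<in> P" "\<sigma> \<notin> fst F" "\<tau> \<notin> fst F"
    using cancelled_labels labels by blast+
qed

lemma differential_span:
  assumes "v \<in> free_mod.span (snd F ` Q)" "\<And>\<rho>. \<rho> \<in> Q \<Longrightarrow> d (snd F \<rho>) \<in> free_mod.span S"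
  shows "d v \<in> free_mod.span S"
proof -
  interpret dh: module_hom smul smul d by (rule hom)
  have "d v \<in> free_mod.span (d ` snd F ` Q)" using assms(1) by (simp add: dh.span_image)
  also have "\<dots> \<subseteq> free_mod.span S"
    by (rule free_mod.span_minimal) (use assms(2) in auto)
  finally show ?thesis .
qed

lemma degree_part_whole:
  "degree_part (P, taylor_basis) j = free_mod.span (snd F ` {\<rho>\<in>P. card \<rho> = j})"
  by (simp add: degree_part_def spans)

lemma degree_part_subset: "degree_part F j \<subseteq> degree_part (P, taylor_basis) j"
  unfolding degree_part_whole unfolding degree_part_def
  by (intro free_mod.span_mono image_mono) (use remaining_subset in auto)

lemma differential_remaining_basis:
  "\<rho> \<in> fst F \<Longrightarrow> card \<rho> = Suc j \<Longrightarrow> d (snd F \<rho>) \<in> degree_part F j"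
  unfolding degree_part_def matrix
  by (rule span_family_memI) (use matrix_card in auto)

lemma differential_remaining: "v \<in> degree_part F (Suc j) \<Longrightarrow> d v \<in> degree_part F j"
  unfolding degree_part_def
  by (erule differential_span) (use differential_remaining_basis in \<open>auto simp: degree_part_def\<close>)

lemma differential_degree_0: "v \<in> degree_part F 0 \<Longrightarrow> d v = 0"
proof -
  assume "v \<in> degree_part F 0"
  then have "d v \<in> free_mod.span {}" unfolding degree_part_def
  proof (rule differential_span)
    fix \<rho> assume \<rho>: "\<rho> \<in> {\<sigma> \<in> fst F. card \<sigma> = 0}"
    have "a \<pi> \<rho> = 0" for \<pi> using matrix_card[of \<pi> \<rho>] \<rho> by auto
    then show "d (snd F \<rho>) \<in> free_mod.span {}" using \<rho> by (simp add: matrix)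
  qed
  then show ?thesis by simp
qed

lemma differential_twice: "v \<in> degree_part (P, taylor_basis) j \<Longrightarrow> d (d v) = 0"
proof -
  interpret dh: module_hom smul smul d by (rule hom)
  assume "v \<in> degree_part (P, taylor_basis) j"
  then obtain c where "v = (\<Sum>\<rho>\<in>{\<rho>\<in>P. card \<rho> = j}. smul (c \<rho>) (snd F \<rho>))"
    unfolding degree_part_whole by (rule span_familyE) (use fin in simp)
  then show ?thesis by (simp add: dh.sum dh.scale dd)
qed

lemma degree_part_decompose:
  assumes "w \<in> degree_part (P, taylor_basis) j"
  obtains w' w'' where "w = w' + w''" "w' \<in> degree_part F j"
    "w'' \<in> free_mod.span (snd F ` {\<rho> \<in> P - fst F. card \<rho> = j})"
proof -
  have "{\<rho>\<in>P. card \<rho> = j} = {\<rho>\<in>fst F. card \<rho> = j} \<union> {\<rho> \<in> P - fst F. card \<rho> = j}"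
    using remaining_subset by auto
  then have "w \<in> free_mod.span (snd F ` {\<rho>\<in>fst F. card \<rho> = j} \<union> snd F ` {\<rho> \<in> P - fst F. card \<rho> = j})"
    using assms unfolding degree_part_whole by (simp add: image_Un)
  then show thesis using that unfolding free_mod.span_Un degree_part_def by auto
qed

text \<open>
  Boundaries of the whole complex that lie in the remaining part are boundaries of the remaining
  part: the cancelled components of a preimage contribute only cancelled components.
\<close>

lemma remaining_boundary:
  assumes w: "w \<in> degree_part (P, taylor_basis) (Suc j)" and dw: "d w \<in> degree_part F j"
  shows "d w \<in> d ` degree_part F (Suc j)"
proof -
  interpret dh: module_hom smul smul d by (rule hom)
  obtain w' w'' where w': "w = w' + w''" "w' \<in> degree_part F (Suc j)"
    and w'': "w'' \<in> free_mod.span (snd F ` {\<rho> \<in> P - fst F. card \<rho> = Suc j})"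
    using degree_part_decompose[OF w] .
  have "d w'' \<in> free_mod.span (snd F ` {\<rho> \<in> P - fst F. card \<rho> = j})"
    using w''
  proof (rule differential_span)
    fix \<rho> assume \<rho>: "\<rho> \<in> {\<rho> \<in> P - fst F. card \<rho> = Suc j}"
    then have "\<rho> \<in> fst ` R \<union> snd ` R" using labels by blast
    then obtain \<sigma> \<tau> where R: "(\<sigma>, \<tau>) \<in> R" "\<rho> = \<sigma> \<or> \<rho> = \<tau>" by auto
    show "d (snd F \<rho>) \<in> free_mod.span (snd F ` {\<rho> \<in> P - fst F. card \<rho> = j})"
    proof (cases "\<rho> = \<sigma>")
      case True
      then have "\<tau> \<in> {\<rho> \<in> P - fst F. card \<rho> = j}"
        using \<rho> cancelled_label[OF R(1)] cancelled_card[OF R(1)] by simp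
      then show ?thesis using True cancelled[OF R(1)] by (auto intro: free_mod.span_base)
    next
      case False
      then have "d (snd F \<rho>) = d (d (snd F \<sigma>))" using R(2) cancelled[OF R(1)] by simp
      then show ?thesis using dd[OF cancelled_label(1)[OF R(1)]] by (simp add: free_mod.span_zero)
    qed
  qed
  moreover have "d w'' = d w - d w'" using w'(1) by (simp add: dh.add)
  then have "d w'' \<in> degree_part F j"
    using dw differential_remaining[OF w'(2)] by (simp add: degree_part_def free_mod.span_diff)
  ultimately have "d w'' = 0"
    using span_family_disjoint[OF indep fin, of "{\<rho> \<in> P - fst F. card \<rho> = j}" "{\<sigma> \<in> fst F. card \<sigma> = j}"]
      remaining_subset by (auto simp: degree_part_def)
  then have "d w = d w'" using w'(1) by (simp add: dh.add)
  then show ?thesis using w'(2) by blast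
qed

text \<open>
  Being a resolution passes to the remaining part, with the same augmentation: it is a direct summand,
  and on its complement \<open>d\<close> maps the chains of the first members of the cancelled pairs bijectively to
  those of the second members, so that the complement is acyclic.
\<close>

lemma remaining_resolution:
  assumes res: "multigraded_free_resolution d M (P, taylor_basis)" and M: "M = ideal_generated E"
  shows "multigraded_free_resolution d M F"
proof -
  interpret dh: module_hom smul smul d by (rule hom)
  interpret Rm: module "(*) :: ('n, 'k) mpoly \<Rightarrow> _ \<Rightarrow> _" by (rule module_ring)
  have M_span: "M = Rm.span E" using M by (simp add: ideal_generated_def)
  obtain \<epsilon> where \<epsilon>: "module_hom smul (*) \<epsilon>"
    and keys_\<epsilon>: "\<forall>m v. v \<in> degree_part (P, taylor_basis) 0 \<and> homogeneous m v \<longrightarrow> Poly_Mapping.keys (\<epsilon> v) \<subseteq> {m}"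
    and onto_\<epsilon>: "\<forall>s. \<exists>v\<in>degree_part (P, taylor_basis) 0. s - \<epsilon> v \<in> M"
    and kernel_\<epsilon>: "d ` degree_part (P, taylor_basis) (Suc 0) = {v \<in> degree_part (P, taylor_basis) 0. \<epsilon> v \<in> M}"
    and exact: "\<forall>j. d ` degree_part (P, taylor_basis) (Suc (Suc j))
                  = {v \<in> degree_part (P, taylor_basis) (Suc j). d v = 0}"
    using res unfolding multigraded_free_resolution_def by (elim conjE exE) (rule that; assumption)
  interpret e: module_hom smul "(*)" \<epsilon> by (rule \<epsilon>)
  show ?thesis unfolding multigraded_free_resolution_def
  proof (intro conjI ballI allI)
    show "free_on F"
      using remaining_finite indep_family_inj_on[OF remaining_indep remaining_finite]
        indep_family_independent[OF remaining_indep remaining_finite] by (simp add: free_on_def)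
    show "module_hom smul smul d" by (rule hom)
    fix \<sigma> assume \<sigma>: "\<sigma> \<in> fst F"
    show "homogeneous (mdeg \<sigma>) (snd F \<sigma>)" using homog remaining_subset \<sigma> by blast
    show "homogeneous (mdeg \<sigma>) (d (snd F \<sigma>))" unfolding matrix[OF \<sigma>]
    proof (rule homogeneous_sum)
      fix \<pi> assume "\<pi> \<in> fst F"
      then have "homogeneous (mdeg \<pi>) (snd F \<pi>)" using homog remaining_subset by blast
      then show "homogeneous (mdeg \<sigma>) (smul (a \<pi> \<sigma>) (snd F \<pi>))"
        by (rule homogeneous_smul) (rule matrix_mdeg)
    qed
  next
    fix j
    show "d ` degree_part F (Suc (Suc j)) = {v \<in> degree_part F (Suc j). d v = 0}"
    proof (intro subset_antisym subsetI)
      fix v assume "v \<in> d ` degree_part F (Suc (Suc j))"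
      then show "v \<in> {v \<in> degree_part F (Suc j). d v = 0}"
        using differential_remaining degree_part_subset differential_twice by blast
    next
      fix v assume v: "v \<in> {v \<in> degree_part F (Suc j). d v = 0}"
      then have "v \<in> d ` degree_part (P, taylor_basis) (Suc (Suc j))"
        unfolding exact[rule_format] using degree_part_subset by blast
      then show "v \<in> d ` degree_part F (Suc (Suc j))" using v remaining_boundary by blast
    qed
  next
    show "\<exists>\<epsilon>. module_hom smul (*) \<epsilon> \<and>
        (\<forall>m v. v \<in> degree_part F 0 \<and> homogeneous m v \<longrightarrow> Poly_Mapping.keys (\<epsilon> v) \<subseteq> {m}) \<and>
        (\<forall>s. \<exists>v\<in>degree_part F 0. s - \<epsilon> v \<in> M) \<and>
        d ` degree_part F (Suc 0) = {v \<in> degree_part F 0. \<epsilon> v \<in> M}"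
    proof (intro exI[of _ \<epsilon>] conjI allI impI)
      show "module_hom smul (*) \<epsilon>" by (rule \<epsilon>)
      show "Poly_Mapping.keys (\<epsilon> v) \<subseteq> {m}" if "v \<in> degree_part F 0 \<and> homogeneous m v" for m v
        using keys_\<epsilon> that degree_part_subset by blast
      show "\<exists>v\<in>degree_part F 0. s - \<epsilon> v \<in> M" for s
      proof -
        obtain v where v: "v \<in> degree_part (P, taylor_basis) 0" "s - \<epsilon> v \<in> M" using onto_\<epsilon> by blast
        obtain v' v'' where v': "v = v' + v''" "v' \<in> degree_part F 0"
          and v'': "v'' \<in> free_mod.span (snd F ` {\<rho> \<in> P - fst F. card \<rho> = 0})"
          using degree_part_decompose[OF v(1)] .
        \<comment> \<open>A cancelled label of degree 0 is the second member of its pair, so its chain is a boundary.\<close>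
        have "v'' \<in> d ` degree_part (P, taylor_basis) (Suc 0)"
        proof -
          have "snd F ` {\<rho> \<in> P - fst F. card \<rho> = 0} \<subseteq> d ` degree_part (P, taylor_basis) (Suc 0)"
          proof (rule image_subsetI)
            fix \<rho> assume \<rho>: "\<rho> \<in> {\<rho> \<in> P - fst F. card \<rho> = 0}"
            then have "\<rho> \<in> fst ` R \<union> snd ` R" using labels by blast
            then obtain \<sigma> \<tau> where R: "(\<sigma>, \<tau>) \<in> R" "\<rho> = \<sigma> \<or> \<rho> = \<tau>" by auto
            have \<sigma>: "card \<sigma> = Suc (card \<tau>)" "d (snd F \<sigma>) = snd F \<tau>"
              using R(1) by (rule cancelled_card, rule cancelled)
            then have "\<rho> = \<tau>" using R(2) \<rho> by auto
            moreover have "\<sigma> \<in> P" using R(1) by (rule cancelled_label)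
            then have "snd F \<sigma> \<in> degree_part (P, taylor_basis) (Suc 0)"
              unfolding degree_part_whole using \<sigma>(1) \<rho> \<open>\<rho> = \<tau>\<close> by (intro free_mod.span_base) auto
            ultimately show "snd F \<rho> \<in> d ` degree_part (P, taylor_basis) (Suc 0)" using \<sigma>(2) by (metis image_eqI)
          qed
          moreover have "free_mod.subspace (d ` degree_part (P, taylor_basis) (Suc 0))"
            by (intro dh.subspace_image) (simp add: degree_part_def)
          ultimately show ?thesis using v'' free_mod.span_minimal by blast
        qed
        then have "\<epsilon> v'' \<in> M" unfolding kernel_\<epsilon> by blast
        then have "(s - \<epsilon> v) + \<epsilon> v'' \<in> M" using v(2) unfolding M_span by (intro Rm.span_add)
        then have "s - \<epsilon> v' \<in> M" using v'(1) by (simp add: e.add)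
        then show ?thesis using v'(2) by blast
      qed
      show "d ` degree_part F (Suc 0) = {v \<in> degree_part F 0. \<epsilon> v \<in> M}"
      proof (intro subset_antisym subsetI)
        fix v assume v: "v \<in> d ` degree_part F (Suc 0)"
        then have "v \<in> d ` degree_part (P, taylor_basis) (Suc 0)" using degree_part_subset by blast
        then have "\<epsilon> v \<in> M" unfolding kernel_\<epsilon> by blast
        then show "v \<in> {v \<in> degree_part F 0. \<epsilon> v \<in> M}" using v differential_remaining by blast
      next
        fix v assume v: "v \<in> {v \<in> degree_part F 0. \<epsilon> v \<in> M}"
        then have "v \<in> d ` degree_part (P, taylor_basis) (Suc 0)"
          unfolding kernel_\<epsilon> using degree_part_subset by blast
        then show "v \<in> d ` degree_part F (Suc 0)" using v remaining_boundary by blast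
      qed
    qed
  qed
qed

text \<open>An entry between different multidegrees has no constant term, because it is homogeneous.\<close>

lemma remaining_minimal:
  assumes "\<And>\<pi> \<rho>. \<pi> \<in> fst F \<Longrightarrow> \<rho> \<in> fst F \<Longrightarrow> card \<rho> = Suc (card \<pi>) \<Longrightarrow> mdeg \<rho> \<noteq> mdeg \<pi>"
  shows "d ` degree_part F (Suc j) \<subseteq>
    free_mod.span {smul p v | p v. p \<in> irrelevant_ideal \<and> v \<in> degree_part F j}"
proof (rule image_subsetI)
  fix v assume "v \<in> degree_part F (Suc j)"
  then show "d v \<in> free_mod.span {smul p v | p v. p \<in> irrelevant_ideal \<and> v \<in> degree_part F j}"
    unfolding degree_part_def[of F "Suc j"]
  proof (rule differential_span)
    fix \<rho> assume \<rho>: "\<rho> \<in> {\<sigma> \<in> fst F. card \<sigma> = Suc j}"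
    then have "d (snd F \<rho>) = (\<Sum>\<pi>\<in>fst F. smul (a \<pi> \<rho>) (snd F \<pi>))" by (simp add: matrix)
    also have "\<dots> \<in> free_mod.span {smul p v | p v. p \<in> irrelevant_ideal \<and> v \<in> degree_part F j}"
    proof (rule free_mod.span_sum)
      fix \<pi> assume \<pi>: "\<pi> \<in> fst F"
      show "smul (a \<pi> \<rho>) (snd F \<pi>) \<in> free_mod.span {smul p v | p v. p \<in> irrelevant_ideal \<and> v \<in> degree_part F j}"
      proof (cases "a \<pi> \<rho> = 0")
        case False
        have card: "card \<rho> = Suc (card \<pi>)" by (rule matrix_card[OF False])
        have ne: "mdeg \<rho> \<noteq> mdeg \<pi>" using assms \<pi> \<rho> card by blast
        have "a \<pi> \<rho> \<in> irrelevant_ideal"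
        proof (rule mem_irrelevant_ideal)
          fix t assume "t \<in> Poly_Mapping.keys (a \<pi> \<rho>)"
          then show "t \<noteq> 0" using matrix_mdeg[of t \<pi> \<rho>] ne by auto
        qed
        moreover have "snd F \<pi> \<in> degree_part F j"
          unfolding degree_part_def using \<pi> \<rho> card by (intro free_mod.span_base) auto
        ultimately show ?thesis by (intro free_mod.span_base) blast
      qed (simp add: free_mod.span_zero)
    qed
    finally show "d (snd F \<rho>) \<in> free_mod.span {smul p v | p v. p \<in> irrelevant_ideal \<and> v \<in> degree_part F j}" .
  qed
qed

lemma splits_off_cancelled:
  assumes disj: "\<And>p q. p \<in> R \<Longrightarrow> q \<in> R \<Longrightarrow> p \<noteq> q \<Longrightarrow> disjoint_pairs p q"
  shows "splits_as d (P, taylor_basis) F R"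
proof -
  interpret dh: module_hom smul smul d by (rule hom)
  let ?I = "insert None (Some ` R)"
  let ?D = "\<lambda>i. case i of None \<Rightarrow> degree_part F | Some (\<sigma>, \<tau>) \<Rightarrow> degree_part ({\<sigma>, \<tau>}, snd F)"
  define L where "L = (\<lambda>i. case i of None \<Rightarrow> fst F | Some (\<sigma>, \<tau>) \<Rightarrow> {\<sigma>, \<tau>})"
  have D: "?D i j = free_mod.span (snd F ` {\<rho> \<in> L i. card \<rho> = j})" for i j
    by (auto simp: L_def degree_part_def split: option.split prod.split)
  note RP = cancelled_label
  have "R \<subseteq> P \<times> P" using RP by auto
  then have finR: "finite R" using fin by (meson finite_SigmaI finite_subset)
  have L_disj: "L i \<inter> L k = {}" if "i \<in> ?I" "k \<in> ?I" "i \<noteq> k" for i k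
  proof (cases i; cases k)
    fix p q assume ik: "i = Some p" "k = Some q"
    then have "disjoint_pairs p q" using disj that by auto
    then show ?thesis using ik by (auto simp: L_def disjoint_pairs_def split: prod.splits)
  qed (use that RP in \<open>auto simp: L_def\<close>)
  have L_union: "P = (\<Union>i\<in>?I. L i)"
  proof (intro subset_antisym subsetI)
    fix \<rho> assume "\<rho> \<in> P"
    then have "\<rho> \<in> fst F \<or> \<rho> \<in> fst ` R \<union> snd ` R" using labels by blast
    then show "\<rho> \<in> (\<Union>i\<in>?I. L i)" by (force simp: L_def)
  next
    fix \<rho> assume "\<rho> \<in> (\<Union>i\<in>?I. L i)"
    then show "\<rho> \<in> P" using RP remaining_subset by (auto simp: L_def)
  qed
  have sum: "internal_direct_sum (degree_part (P, taylor_basis) j) ?I (\<lambda>i. ?D i j)" for j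
    unfolding degree_part_whole D
  proof (rule internal_direct_sum_partition)
    show "indep_family {\<rho> \<in> P. card \<rho> = j} (snd F)"
      by (rule indep_family_subset[OF indep _ fin]) auto
    show "{\<rho> \<in> P. card \<rho> = j} = (\<Union>i\<in>?I. {\<rho> \<in> L i. card \<rho> = j})"
      by (subst L_union) auto
    show "{\<rho> \<in> L i. card \<rho> = j} \<inter> {\<rho> \<in> L k. card \<rho> = j} = {}" if "i \<in> ?I" "k \<in> ?I" "i \<noteq> k" for i k
      using L_disj[OF that] by blast
  qed (use fin finR in auto)
  have pair_basis: "d (snd F \<rho>) \<in> free_mod.span (snd F ` {\<rho> \<in> {\<sigma>, \<tau>}. Suc (card \<rho>) = j})"
    if R: "(\<sigma>, \<tau>) \<in> R" and \<rho>: "\<rho> \<in> {\<rho> \<in> {\<sigma>, \<tau>}. card \<rho> = j}" for \<sigma> \<tau> \<rho> j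
  proof (cases "\<rho> = \<sigma>")
    case True
    then show ?thesis using \<rho> cancelled[OF R] cancelled_card[OF R] by (auto intro: free_mod.span_base)
  next
    case False
    then have "d (snd F \<rho>) = d (d (snd F \<sigma>))" using \<rho> cancelled[OF R] by auto
    then show ?thesis using dd[OF RP(1)[OF R]] by (simp add: free_mod.span_zero)
  qed
  have pair: "d v \<in> free_mod.span (snd F ` {\<rho> \<in> {\<sigma>, \<tau>}. Suc (card \<rho>) = j})"
    if "(\<sigma>, \<tau>) \<in> R" "v \<in> degree_part ({\<sigma>, \<tau>}, snd F) j" for \<sigma> \<tau> v j
    using that(2) unfolding degree_part_def fst_conv snd_conv
    by (rule differential_span) (rule pair_basis[OF that(1)])
  have "complex_direct_sum d (degree_part (P, taylor_basis)) ?I ?D"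
    unfolding complex_direct_sum_def
  proof (intro conjI allI ballI)
    show "internal_direct_sum (degree_part (P, taylor_basis) j) ?I (\<lambda>i. ?D i j)" for j by (rule sum)
    fix i assume i: "i \<in> ?I"
    show "d ` ?D i 0 \<subseteq> {0}"
    proof (cases i)
      case None
      then show ?thesis using differential_degree_0 by auto
    next
      case (Some p)
      obtain \<sigma> \<tau> where p: "p = (\<sigma>, \<tau>)" by (cases p)
      have "(\<sigma>, \<tau>) \<in> R" using i Some p by auto
      then show ?thesis using pair[of \<sigma> \<tau> _ 0] Some p by auto
    qed
    show "d ` ?D i (Suc j) \<subseteq> ?D i j" for j
    proof (cases i)
      case None
      then show ?thesis using differential_remaining by auto
    next
      case (Some p)
      obtain \<sigma> \<tau> where p: "p = (\<sigma>, \<tau>)" by (cases p)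
      have "(\<sigma>, \<tau>) \<in> R" using i Some p by auto
      then show ?thesis using pair[of \<sigma> \<tau> _ "Suc j"] Some p by (auto simp: degree_part_def)
    qed
  qed
  moreover have "free_on ({\<sigma>, \<tau>}, snd F)" if R: "(\<sigma>, \<tau>) \<in> R" for \<sigma> \<tau>
  proof -
    have ind: "indep_family {\<sigma>, \<tau>} (snd F)" by (rule indep_family_subset[OF indep _ fin]) (use RP[OF R] in auto)
    show ?thesis
      using indep_family_inj_on[OF ind] indep_family_independent[OF ind] unfolding free_on_def by simp
  qed
  ultimately show ?thesis unfolding splits_as_def using cancelled by auto
qed

end

section \<open>Cancellations in the Taylor resolution of a 2-semidominant ideal\<close>

theorem theorem6p5:
  fixes M :: "('n::finite, 'k::field) mpoly set"
    and ls :: "'n mon list"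
    and ps :: "('n symbol \<times> 'n symbol) list"
  assumes "two_semidominant M"
    and "minimal_generating_set M (set ls)" and "distinct ls"
    and "maximal_cancellation_family (set ls) (set ps)" and "distinct ps"
  shows "\<exists>F. standard_cancellations (taylor_diff ls) (taylor_based ls) ps F \<and>
             minimal_free_resolution (taylor_diff ls) M F \<and>
             splits_as (taylor_diff ls) (taylor_based ls) F (set ps)"
proof -
  let ?G = "set ls"
  have G: "finite ?G" "card {m \<in> ?G. \<not> dominant ?G m} = 2"
    using two_semidominant_nondominant[OF assms(1,2)] by simp_all
  have M: "ideal_generated (monom ` ?G) = M" using assms(2) by (simp add: minimal_generating_set_def)
  have fam: "cancellation_family ?G (set ps)" using assms(4) by (simp add: maximal_cancellation_family_def)
  have pair: "\<sigma> \<subseteq> ?G" "\<tau> \<subseteq> ?G" "facet \<tau> \<sigma>" "mdeg \<sigma> = mdeg \<tau>" if "(\<sigma>, \<tau>) \<in> set ps" for \<sigma> \<tau>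
    using fam that unfolding cancellation_family_def by auto
  have disj: "disjoint_pairs p q" if "p \<in> set ps" "q \<in> set ps" "p \<noteq> q" for p q
    using fam that unfolding cancellation_family_def by blast
  have pair_card: "card \<sigma> = Suc (card \<tau>)" if "(\<sigma>, \<tau>) \<in> set ps" for \<sigma> \<tau>
  proof -
    have "finite \<sigma>" using pair(1)[OF that] by (auto intro: finite_subset)
    then show ?thesis using pair(3)[OF that] card_Suc_Diff1[of \<sigma>] by (auto simp: facet_def)
  qed
  let ?d = "taylor_diff ls :: ('n, 'k) chain \<Rightarrow> ('n, 'k) chain"
  have "\<exists>F a. standard_cancellations ?d (taylor_based ls) ps F \<and> split_stage ?d (Pow ?G) ({} \<union> set ps) F a"
  proof (rule cancel_pairs[OF taylor_split_stage[OF assms(3)] assms(5)])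
    fix \<sigma> \<tau> assume p: "(\<sigma>, \<tau>) \<in> set ps"
    then show "\<sigma> \<in> fst (taylor_based ls :: ('n, 'k) based) \<and> \<tau> \<in> fst (taylor_based ls :: ('n, 'k) based) \<and>
        mdeg \<sigma> = mdeg \<tau> \<and> (\<exists>c. c \<noteq> 0 \<and>
          (if \<sigma> \<subseteq> ?G then Poly_Mapping.lookup (taylor_boundary ls \<sigma> :: ('n, 'k) chain) \<tau> else 0)
            = Poly_Mapping.single 0 c)"
      using pair[OF p] taylor_boundary_entry[OF assms(3) pair(1)[OF p] pair(3)[OF p] pair(4)[OF p]]
      by (simp add: taylor_based_def)
  next
    fix p q assume pq: "p \<in> set ps" "q \<in> set ps" "p \<noteq> q"
    then show "disjoint_pairs p q" by (rule disj)
    assume card: "card (fst p) = card (fst q)"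
    obtain \<sigma> \<tau> \<sigma>' \<tau>' where p: "p = (\<sigma>, \<tau>)" and q: "q = (\<sigma>', \<tau>')" by (cases p, cases q)
    note pair_p = pair[OF pq(1)[unfolded p]] pair_card[OF pq(1)[unfolded p]]
    note pair_q = pair[OF pq(2)[unfolded q]] pair_card[OF pq(2)[unfolded q]]
    show "mdeg (fst p) \<noteq> mdeg (fst q)"
    proof
      assume "mdeg (fst p) = mdeg (fst q)"
      then have "\<sigma> = \<sigma>' \<or> \<tau> = \<tau>'"
        using mdeg_eq_pairs_meet[OF G pair_p(1,2) pair_q(1,2) pair_p(4) pair_q(4) _ pair_p(5) pair_q(5)] card
        by (simp add: p q)
      then show False using disj[OF pq] by (auto simp: disjoint_pairs_def p q)
    qed
  qed
  then obtain F a where F: "standard_cancellations ?d (taylor_based ls) ps F"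
    and stage: "split_stage ?d (Pow ?G) (set ps) F a" by auto
  interpret split_stage ?d "Pow ?G" "set ps" F a by (rule stage)
  \<comment> \<open>A remaining pair of equal multidegree and adjacent degrees could be added to the family.\<close>
  have remaining: "mdeg \<rho> \<noteq> mdeg \<pi>"
    if \<pi>: "\<pi> \<in> fst F" and \<rho>: "\<rho> \<in> fst F" and card: "card \<rho> = Suc (card \<pi>)" for \<pi> \<rho>
  proof
    assume mdeg: "mdeg \<rho> = mdeg \<pi>"
    have sub: "\<rho> \<subseteq> ?G" "\<pi> \<subseteq> ?G" using \<pi> \<rho> remaining_subset by auto
    have fresh: "\<rho> \<notin> fst ` set ps \<union> snd ` set ps" "\<pi> \<notin> fst ` set ps \<union> snd ` set ps"
      using \<pi> \<rho> labels by auto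
    have "facet \<pi> \<rho>" by (rule mdeg_eq_imp_facet[OF G sub mdeg card])
    moreover have "disjoint_pairs (\<rho>, \<pi>) q" "disjoint_pairs q (\<rho>, \<pi>)" if "q \<in> set ps" for q
      using fresh that by (force simp: disjoint_pairs_def)+
    ultimately have "cancellation_family ?G (insert (\<rho>, \<pi>) (set ps))"
      using fam sub mdeg unfolding cancellation_family_def by auto
    then have "insert (\<rho>, \<pi>) (set ps) = set ps"
      using assms(4) unfolding maximal_cancellation_family_def by blast
    then have "(\<rho>, \<pi>) \<in> set ps" by blast
    then have "\<rho> \<in> fst ` set ps" by (metis fst_conv image_eqI)
    then show False using fresh(1) by blast
  qed
  have T: "taylor_based ls = (Pow ?G, taylor_basis :: 'n symbol \<Rightarrow> ('n, 'k) chain)"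
    by (simp add: taylor_based_def)
  have res: "multigraded_free_resolution ?d M F"
    using remaining_resolution[OF taylor_resolution[OF assms(3) M, unfolded T] M[symmetric]] .
  have "minimal_free_resolution ?d M F"
    unfolding minimal_free_resolution_def by (intro conjI allI res remaining_minimal) (rule remaining)
  moreover have "splits_as ?d (taylor_based ls) F (set ps)"
    unfolding T by (rule splits_off_cancelled[OF disj])
  ultimately show ?thesis using F by blast
qed

end
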